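(* Let $n\ge 2$. A typical convex body $K$ of constant width $1$ in $\mathbb{R}^n$ has the following property. Let $(x,u)$ be any support element of $K$; then $(x,u)$ is regular and either $$\bar\varrho_s(K,u,t)=1\qquad\text{for all } t\in u^\perp\cap\mathbb{S}^{n-1}$$ or $$\varrho_i(K,u,t)=0\qquad\text{for at least one } t\in u^\perp\cap\mathbb{S}^{n-1}.$$
   Context: $\mathbb{S}^{n-1}$ is the unit sphere of $\mathbb{R}^n$ and $u^\perp$ is the orthogonal complement of $u$. A convex body is a nonempty compact convex subset of $\mathbb{R}^n$; $h(K,u)=\max\{\langle x,u\rangle:x\in K\}$ is its support function. $K$ has constant width $1$ if $h(K,u)+h(K,-u)=1$ for all $u\in\mathbb{S}^{n-1}$. $\mathcal{W}^n_1$ is the set of convex bodies of constant width $1$ in $\mathbb{R}^n$, with the Hausdorff metric; it is a complete metric space. "A typical convex body of constant width $1$ has property $P$" means that the set of all $K\in\mathcal{W}^n_1$ having property $P$ is comeagre in $\mathcal{W}^n_1$ (its complement in $\mathcal{W}^n_1$ is a countable union of nowhere dense sets). A support element of $K$ is a pair $(x,u)$ where $x$ is a boundary point of $K$ and $u$ is an outer unit normal vector of $K$ at $x$. It is regular if $u$ is the only outer unit normal vector of $K$ at $x$ and $x$ is the only boundary point of $K$ at which $u$ is an outer normal vector. Every $K\in\mathcal{W}^n_1$ is strictly convex, so for each $u\in\mathbb{S}^{n-1}$ there is a unique boundary point $x_K(u)$ of $K$ at which $u$ is an outer normal vector. Planar radii of curvature: let $M$ be a two-dimensional convex body in a two-dimensional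 plane, $x$ a (relative) boundary point of $M$, $u$ an outer unit normal vector of $M$ at $x$ in the plane, and $t\perp u$ a unit vector parallel to the plane. Let $E=\{x+\lambda u+\mu t:\lambda\in\mathbb{R},\ \mu>0\}$ and assume that $E$ meets the relative boundary of $M$. For a relative boundary point $z$ of $M$ in $E$, let $r(z)$ be the radius of the unique circle in the plane with centre on the ray $\{x-\lambda u:\lambda\ge0\}$ passing through $x$ and $z$, and put $r(z)=\infty$ if $z\in\{x+\mu t:\mu>0\}$. Define $\varrho_i(M,x,u,t)=\liminf_{z\to x}r(z)$ and $\varrho_s(M,x,u,t)=\limsup_{z\to x}r(z)$ (with $z$ in $E$ and in the relative boundary of $M$), both in $[0,\infty]$. For $K\in\mathcal{W}^n_1$, $u\in\mathbb{S}^{n-1}$, $x=x_K(u)$ and $t\in u^\perp\cap\mathbb{S}^{n-1}$, let $L_{x,u,t}=x+\mathrm{lin}\{u,t\}$, and let $K|L_{x,u,t}$ be the orthogonal projection of $K$ to $L_{x,u,t}$. The lower (sectional) radius of curvature is $\varrho_i(K,u,t):=\varrho_i(K\cap L_{x,u,t},x,u,t)$, and the upper tangential radius of curvature is $\bar\varrho_s(K,u,t):=\varrho_s(K|L_{x,u,t},x,u,t)$. *)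

theory Defs
  imports "HOL-Analysis.Analysis"
begin

section \<open>Baire category\<close>

definition nowhere_dense_in :: "'a topology \<Rightarrow> 'a set \<Rightarrow> bool" where
  "nowhere_dense_in X N \<longleftrightarrow> N \<subseteq> topspace X \<and> X interior_of (X closure_of N) = {}"

definition comeagre_in :: "'a topology \<Rightarrow> 'a set \<Rightarrow> bool" where
  "comeagre_in X S \<longleftrightarrow> S \<subseteq> topspace X \<and>
    (\<exists>\<N>. countable \<N> \<and> (\<forall>N\<in>\<N>. nowhere_dense_in X N) \<and> topspace X - S = \<Union>\<N>)"


section \<open>Convex bodies of constant width\<close>

definition convex_body :: "'a::euclidean_space set \<Rightarrow> bool" where
  "convex_body K \<longleftrightarrow> K \<noteq> {} \<and> compact K \<and> convex K"

text \<open>On a nonempty compact set the supremum is attained, see \<open>support_fun_attained\<close> below.\<close>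

definition support_fun :: "'a::euclidean_space set \<Rightarrow> 'a \<Rightarrow> real" where
  "support_fun K u = (SUP x\<in>K. x \<bullet> u)"

definition constant_width_1 :: "'a::euclidean_space set \<Rightarrow> bool" where
  "constant_width_1 K \<longleftrightarrow> (\<forall>u\<in>sphere 0 1. support_fun K u + support_fun K (- u) = 1)"

definition bodies_of_constant_width_1 :: "'a::euclidean_space set set" where
  "bodies_of_constant_width_1 = {K. convex_body K \<and> constant_width_1 K}"

text \<open>The value \<open>0\<close> outside the nonempty bounded sets is a convention that makes the function
  nonnegative everywhere, as the library locale \<open>Metric_space\<close> requires.\<close>

definition hausdorff_dist :: "'a::metric_space set \<Rightarrow> 'a set \<Rightarrow> real" where
  "hausdorff_dist A B =
    (if A \<noteq> {} \<and> B \<noteq> {} \<and> bounded A \<and> bounded B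
     then max (SUP a\<in>A. infdist a B) (SUP b\<in>B. infdist b A) else 0)"

text \<open>The library topology induced by a metric on a carrier set; it is the intended one because
  of \<open>Metric_space_constant_width_1\<close> below.\<close>

definition constant_width_1_topology :: "'a::euclidean_space set topology" where
  "constant_width_1_topology =
    Metric_space.mtopology bodies_of_constant_width_1 hausdorff_dist"

definition typical_constant_width_1 :: "('a::euclidean_space set \<Rightarrow> bool) \<Rightarrow> bool" where
  "typical_constant_width_1 P \<longleftrightarrow>
    comeagre_in constant_width_1_topology {K \<in> bodies_of_constant_width_1. P K}"


section \<open>Support elements\<close>

definition outer_unit_normal :: "'a::euclidean_space set \<Rightarrow> 'a \<Rightarrow> 'a \<Rightarrow> bool" where
  "outer_unit_normal K x u \<longleftrightarrow> norm u = 1 \<and> (\<forall>y\<in>K. y \<bullet> u \<le> x \<bullet> u)"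

text \<open>For the closed sets considered here, the frontier is contained in the set.\<close>

definition support_element :: "'a::euclidean_space set \<Rightarrow> 'a \<Rightarrow> 'a \<Rightarrow> bool" where
  "support_element K x u \<longleftrightarrow> x \<in> frontier K \<and> outer_unit_normal K x u"

definition regular_support_element :: "'a::euclidean_space set \<Rightarrow> 'a \<Rightarrow> 'a \<Rightarrow> bool" where
  "regular_support_element K x u \<longleftrightarrow> support_element K x u \<and>
    (\<forall>v. outer_unit_normal K x v \<longrightarrow> v = u) \<and>
    (\<forall>y\<in>frontier K. outer_unit_normal K y u \<longrightarrow> y = x)"

text \<open>The point \<open>x\<^sub>K(u)\<close>, well defined for bodies of constant width by
  \<open>constant_width_1_unique_support_point\<close> below.\<close>

definition support_point :: "'a::euclidean_space set \<Rightarrow> 'a \<Rightarrow> 'a" where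
  "support_point K u = (THE x. support_element K x u)"


section \<open>Planar radii of curvature\<close>

text \<open>Throughout, \<open>u\<close> and \<open>t\<close> are orthogonal unit vectors, and \<open>M\<close> is a two-dimensional convex
  body contained in \<open>x + lin {u, t}\<close>, having \<open>x\<close> as a relative boundary point and \<open>u\<close> as an outer
  normal vector at \<open>x\<close>.\<close>

definition open_half_plane :: "'a::euclidean_space \<Rightarrow> 'a \<Rightarrow> 'a \<Rightarrow> 'a set" where
  "open_half_plane x u t = {x + l *\<^sub>R u + m *\<^sub>R t | l m. m > 0}"

text \<open>Spheres are used in place of circles in the plane: the centre and the two
  points lie in the plane, so the radius is the same.\<close>

definition circle_radius :: "'a::euclidean_space \<Rightarrow> 'a \<Rightarrow> 'a \<Rightarrow> 'a \<Rightarrow> ennreal" where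
  "circle_radius x u t z =
    (if z \<in> {x + m *\<^sub>R t | m. m > 0} then \<infinity>
     else ennreal (THE r. \<exists>c \<in> {x - l *\<^sub>R u | l. l \<ge> 0}. x \<in> sphere c r \<and> z \<in> sphere c r))"

definition planar_lower_radius :: "'a::euclidean_space set \<Rightarrow> 'a \<Rightarrow> 'a \<Rightarrow> 'a \<Rightarrow> ennreal" where
  "planar_lower_radius M x u t =
    Liminf (at x within (open_half_plane x u t \<inter> rel_frontier M)) (circle_radius x u t)"

definition planar_upper_radius :: "'a::euclidean_space set \<Rightarrow> 'a \<Rightarrow> 'a \<Rightarrow> 'a \<Rightarrow> ennreal" where
  "planar_upper_radius M x u t =
    Limsup (at x within (open_half_plane x u t \<inter> rel_frontier M)) (circle_radius x u t)"


section \<open>Sectional and tangential radii of curvature\<close>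

definition plane_through :: "'a::euclidean_space \<Rightarrow> 'a \<Rightarrow> 'a \<Rightarrow> 'a set" where
  "plane_through x u t = (+) x ` span {u, t}"

definition orthogonal_projection :: "'a::euclidean_space set \<Rightarrow> 'a set \<Rightarrow> 'a set" where
  "orthogonal_projection K L = {y \<in> L. \<exists>z\<in>K. \<forall>v\<in>L. orthogonal (z - y) (v - y)}"

definition lower_sectional_radius :: "'a::euclidean_space set \<Rightarrow> 'a \<Rightarrow> 'a \<Rightarrow> ennreal" where
  "lower_sectional_radius K u t =
    (let x = support_point K u in planar_lower_radius (K \<inter> plane_through x u t) x u t)"

definition upper_tangential_radius :: "'a::euclidean_space set \<Rightarrow> 'a \<Rightarrow> 'a \<Rightarrow> ennreal" where
  "upper_tangential_radius K u t =
    (let x = support_point K u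
     in planar_upper_radius (orthogonal_projection K (plane_through x u t)) x u t)"


section \<open>Well-definedness\<close>

lemma support_fun_attained:
  fixes K :: "'a::euclidean_space set"
  assumes "compact K" "K \<noteq> {}"
  shows "\<exists>x\<in>K. support_fun K u = x \<bullet> u \<and> (\<forall>y\<in>K. y \<bullet> u \<le> x \<bullet> u)"
proof -
  have "continuous_on K (\<lambda>y. y \<bullet> u)" by (intro continuous_intros)
  then obtain x where x: "x \<in> K" "\<forall>y\<in>K. y \<bullet> u \<le> x \<bullet> u"
    using continuous_attains_sup[OF assms] by blast
  then have "support_fun K u = x \<bullet> u"
    unfolding support_fun_def by (intro cSup_eq_maximum) auto
  with x show ?thesis by blast
qed

lemma constant_width_1_unique_support_point:
  fixes K :: "'a::euclidean_space set"
  assumes K: "K \<in> bodies_of_constant_width_1" and u: "norm u = 1"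
  shows "\<exists>!x. support_element K x u"
proof -
  have c: "compact K" "K \<noteq> {}"
    using K by (auto simp: bodies_of_constant_width_1_def convex_body_def)
  have w: "support_fun K v + support_fun K (- v) = 1" if "norm v = 1" for v
    using K that by (auto simp: bodies_of_constant_width_1_def constant_width_1_def)
  have le: "y \<bullet> v \<le> support_fun K v" if "y \<in> K" for y v
    using support_fun_attained[OF c, of v] that by auto
  obtain x where x: "x \<in> K" "\<forall>y\<in>K. y \<bullet> u \<le> x \<bullet> u"
    using support_fun_attained[OF c] by blast
  have "x \<notin> interior K"
  proof
    assume "x \<in> interior K"
    then obtain e where e: "e > 0" "ball x e \<subseteq> K"
      by (auto simp: mem_interior)
    then have "x + (e/2) *\<^sub>R u \<in> K" using u by (intro subsetD[OF e(2)]) (simp add: dist_norm)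
    then have "(x + (e/2) *\<^sub>R u) \<bullet> u \<le> x \<bullet> u" using x by blast
    moreover have "u \<bullet> u = 1" using u by (simp add: norm_eq_1)
    ultimately show False using e by (simp add: inner_add_left)
  qed
  then have 1: "support_element K x u"
    using x u closure_subset[of K] by (auto simp: support_element_def outer_unit_normal_def frontier_def)
  obtain z where z: "z \<in> K" "support_fun K (- u) = z \<bullet> (- u)"
    using support_fun_attained[OF c] by blast
  have "y = z + u" if y: "support_element K y u" for y
  proof -
    have yK: "y \<in> K"
      using y c by (auto simp: support_element_def frontier_def closure_closed compact_imp_closed)
    have "support_fun K u = y \<bullet> u"
      using support_fun_attained[OF c, of u] y yK
      by (fastforce simp: support_element_def outer_unit_normal_def)
    then have d: "(y - z) \<bullet> u = 1"
      using w[OF u] z by (simp add: inner_diff_left)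
    then have nz: "y - z \<noteq> 0" by auto
    let ?v = "sgn (y - z)"
    have nv: "norm ?v = 1" using nz by (simp add: norm_sgn)
    have "(y - z) \<bullet> ?v = norm (y - z)"
      using nz by (simp add: sgn_div_norm divide_inverse power2_norm_eq_inner[symmetric] power2_eq_square)
    moreover have "(y - z) \<bullet> ?v \<le> 1"
      using w[OF nv] le[OF yK, of ?v] le[OF z(1), of "- ?v"] by (simp add: inner_diff_left)
    ultimately have "norm (y - z) \<le> 1" by simp
    then have "(norm (y - z))\<^sup>2 \<le> 1" by (simp add: abs_square_le_1)
    moreover have "(norm ((y - z) - u))\<^sup>2 = (norm (y - z))\<^sup>2 - 2 * ((y - z) \<bullet> u) + (norm u)\<^sup>2"
      by (simp add: power2_norm_eq_inner inner_diff_left inner_diff_right inner_commute)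
    ultimately have "(norm ((y - z) - u))\<^sup>2 \<le> 0" using d u by simp
    then have "(y - z) - u = 0" by simp
    then show ?thesis by (simp add: algebra_simps)
  qed
  with 1 show ?thesis by metis
qed

lemma circle_radius_eq:
  fixes x u t :: "'a::euclidean_space"
  assumes "norm u = 1" "norm t = 1" "orthogonal u t" and l: "l < 0" and m: "m > 0"
  shows "circle_radius x u t (x + l *\<^sub>R u + m *\<^sub>R t) = ennreal ((l\<^sup>2 + m\<^sup>2) / (- 2 * l))"
proof -
  let ?z = "x + l *\<^sub>R u + m *\<^sub>R t"
  have uu: "u \<bullet> u = 1" "t \<bullet> t = 1" "u \<bullet> t = 0" "t \<bullet> u = 0"
    using assms by (auto simp: norm_eq_1 orthogonal_def inner_commute)
  have notray: "?z \<notin> {x + m *\<^sub>R t | m. m > 0}"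
  proof
    assume "?z \<in> {x + m *\<^sub>R t | m. m > 0}"
    then obtain m' where "l *\<^sub>R u + m *\<^sub>R t = m' *\<^sub>R t" by (auto simp: add.assoc)
    then have "(l *\<^sub>R u + m *\<^sub>R t) \<bullet> u = (m' *\<^sub>R t) \<bullet> u" by simp
    then show False using uu l by (simp add: inner_add_left)
  qed
  have sq: "(dist (x - a *\<^sub>R u) ?z)\<^sup>2 = (a + l)\<^sup>2 + m\<^sup>2" for a
  proof -
    have "?z - (x - a *\<^sub>R u) = (a + l) *\<^sub>R u + m *\<^sub>R t" by (simp add: algebra_simps)
    then have "(dist (x - a *\<^sub>R u) ?z)\<^sup>2 = (norm ((a + l) *\<^sub>R u + m *\<^sub>R t))\<^sup>2"
      by (metis dist_commute dist_norm)
    also have "\<dots> = (a + l)\<^sup>2 + m\<^sup>2"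
      unfolding power2_norm_eq_inner
      by (simp add: inner_add_left inner_add_right uu power2_eq_square)
    finally show ?thesis .
  qed
  have r: "(\<exists>c \<in> {x - a *\<^sub>R u | a. a \<ge> 0}. x \<in> sphere c r \<and> ?z \<in> sphere c r)
      \<longleftrightarrow> r = (l\<^sup>2 + m\<^sup>2) / (- 2 * l)" (is "?L \<longleftrightarrow> ?R") for r
  proof -
    have dx: "dist (x - a *\<^sub>R u) x = a" if "a \<ge> 0" for a
      using that assms by (simp add: dist_norm)
    have eq: "a = (l\<^sup>2 + m\<^sup>2) / (- 2 * l) \<longleftrightarrow> (a + l)\<^sup>2 + m\<^sup>2 = a\<^sup>2" for a
      using l by (auto simp: field_simps power2_eq_square)
    have pos: "(l\<^sup>2 + m\<^sup>2) / (- 2 * l) \<ge> 0" using l by (intro divide_nonneg_nonneg) auto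
    have "?L \<longleftrightarrow> (\<exists>a\<ge>0. a = r \<and> dist (x - a *\<^sub>R u) ?z = a)"
      using dx by fastforce
    also have "\<dots> \<longleftrightarrow> (\<exists>a\<ge>0. a = r \<and> (a + l)\<^sup>2 + m\<^sup>2 = a\<^sup>2)"
      using sq by (metis power2_eq_iff_nonneg zero_le_dist)
    also have "\<dots> \<longleftrightarrow> ?R" using eq pos by metis
    finally show ?thesis .
  qed
  show ?thesis
    unfolding circle_radius_def if_not_P[OF notray] r by simp
qed

lemma hausdorff_dist_le_iff:
  fixes A B :: "'a::metric_space set"
  assumes A: "bounded A" "A \<noteq> {}" and B: "bounded B" "B \<noteq> {}"
  shows "hausdorff_dist A B \<le> d \<longleftrightarrow> (\<forall>a\<in>A. infdist a B \<le> d) \<and> (\<forall>b\<in>B. infdist b A \<le> d)"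
proof -
  have bdd: "bdd_above ((\<lambda>a. infdist a B) ` A)" if A: "bounded A" and B: "B \<noteq> {}" for A B :: "'a set"
  proof -
    obtain b where b: "b \<in> B" using B by blast
    obtain e where "\<forall>a\<in>A. dist b a \<le> e" using A bounded_any_center by metis
    then have "infdist a B \<le> e" if "a \<in> A" for a
      using infdist_le[OF b, of a] that by (auto simp: dist_commute intro: order_trans)
    then show ?thesis by (rule bdd_aboveI2)
  qed
  show ?thesis
    using cSUP_le_iff[OF A(2) bdd[OF A(1) B(2)], of d] cSUP_le_iff[OF B(2) bdd[OF B(1) A(2)], of d]
      assms
    by (auto simp: hausdorff_dist_def)
qed

lemma Metric_space_hausdorff_dist:
  "Metric_space {A :: 'a::metric_space set. compact A \<and> A \<noteq> {}} hausdorff_dist"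
proof -
  have bd: "infdist a B \<le> hausdorff_dist A B"
    if "bounded A" "A \<noteq> {}" "bounded B" "B \<noteq> {}" "a \<in> A" for A B :: "'a set" and a
    using hausdorff_dist_le_iff[OF that(1-4), of "hausdorff_dist A B"] that by auto
  have comm: "hausdorff_dist A B = hausdorff_dist B A" for A B :: "'a set"
    by (auto simp: hausdorff_dist_def max.commute)
  have nonneg: "0 \<le> hausdorff_dist A B" for A B :: "'a set"
  proof (cases "A \<noteq> {} \<and> B \<noteq> {} \<and> bounded A \<and> bounded B")
    case True
    then obtain a where "a \<in> A" by blast
    then show ?thesis using bd[of A B a] True infdist_nonneg[of a B] by simp
  qed (simp only: hausdorff_dist_def if_False order_refl)
  have near: "infdist a C \<le> hausdorff_dist A B + hausdorff_dist B C"
    if A: "compact A" "A \<noteq> {}" and B: "compact B" "B \<noteq> {}" and C: "compact C" "C \<noteq> {}"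
      and a: "a \<in> A"
    for A B C :: "'a set" and a
  proof -
    have "continuous_on B (dist a)" by (intro continuous_intros)
    then obtain b where b: "b \<in> B" "\<And>y. y \<in> B \<Longrightarrow> dist a b \<le> dist a y"
      using continuous_attains_inf[OF B] by blast
    then have "infdist a B = dist a b"
      using B by (auto simp: infdist_def intro!: cInf_eq_minimum)
    moreover have "infdist a C \<le> infdist b C + dist a b"
      by (rule infdist_triangle)
    moreover have "infdist b C \<le> hausdorff_dist B C" "infdist a B \<le> hausdorff_dist A B"
      using bd that b by (simp_all add: compact_imp_bounded)
    ultimately show ?thesis by simp
  qed
  have sub: "A \<subseteq> B"
    if "compact A" "A \<noteq> {}" "compact B" "B \<noteq> {}" "hausdorff_dist A B = 0" for A B :: "'a set"
  proof
    fix a assume "a \<in> A"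
    then have "infdist a B = 0"
      using bd[of A B a] that infdist_nonneg[of a B] by (simp add: compact_imp_bounded)
    then show "a \<in> B"
      using that in_closed_iff_infdist_zero compact_imp_closed by blast
  qed
  show ?thesis
  proof (rule Metric_space.intro)
    fix A B :: "'a set"
    assume AB: "A \<in> {A. compact A \<and> A \<noteq> {}}" "B \<in> {A. compact A \<and> A \<noteq> {}}"
    have "hausdorff_dist A A \<le> 0"
      using AB hausdorff_dist_le_iff[of A A 0] by (simp add: compact_imp_bounded)
    then have "hausdorff_dist A A = 0" using nonneg[of A A] by simp
    then show "hausdorff_dist A B = 0 \<longleftrightarrow> A = B"
      using sub[of A B] sub[of B A] comm[of A B] AB by auto
  next
    fix A B C :: "'a set"
    assume "A \<in> {A. compact A \<and> A \<noteq> {}}" "B \<in> {A. compact A \<and> A \<noteq> {}}"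
      "C \<in> {A. compact A \<and> A \<noteq> {}}"
    then show "hausdorff_dist A C \<le> hausdorff_dist A B + hausdorff_dist B C"
      using near[of A B C] near[of C B A] comm[of A B] comm[of B C]
        hausdorff_dist_le_iff[of A C "hausdorff_dist A B + hausdorff_dist B C"]
      by (auto simp: compact_imp_bounded add.commute)
  qed (fact nonneg comm)+
qed

lemma Metric_space_constant_width_1:
  "Metric_space (bodies_of_constant_width_1 :: 'a::euclidean_space set set) hausdorff_dist"
  by (rule Metric_space.subspace[OF Metric_space_hausdorff_dist])
    (auto simp: bodies_of_constant_width_1_def convex_body_def)

end

theory Submission
  imports Defs
begin

text \<open>A body \<open>K\<close> fails the required property only if it has two outer normals at one boundary point, or
if at some support element \<open>(x, u)\<close> all sectional radii are positive while in some direction \<open>t\<close>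
the upper tangential radius is not \<open>1\<close>. Since \<open>K\<close> lies in the unit ball with centre \<open>x - u\<close>,
tangential radii never exceed \<open>1\<close>, so the radius in direction \<open>t\<close> is then below some \<open>1 - \<rho>\<close>. If
\<open>u\<close> is the only normal at \<open>x\<close>, positive sectional radii in the directions \<open>\<plusminus>b\<close>, where \<open>b\<close> runs through an orthonormal basis of \<open>u\<^sup>\<bottom>\<close>,
give by convexity a whole ball inside \<open>K\<close> that touches the boundary at \<open>x\<close>. So the bad bodies are
covered by the countably many sets \<open>nonsmooth_bodies \<rho>\<close> and \<open>subunit_radius_bodies d \<rho>\<close>, where
\<open>\<rho>\<close> runs through the numbers \<open>1/(k+1)\<close> and the normals \<open>u\<close> are restricted to small caps with
centres \<open>d\<close> from a countable dense set. By compactness of the set of possible \<open>(x, u, t)\<close> each of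
these sets is closed.

It remains to show that their complements are dense. For the nonsmooth bodies one takes the
combination of \<open>K\<close> with a small ball. For the others the key is
\<open>locally_spherical_approximation\<close>. Take a smooth body \<open>K\<close>. For finitely many normals \<open>v\<close> in the cap,
move the point opposite to \<open>x\<^sub>K(v)\<close> slightly out of \<open>K\<close>, and cut \<open>K\<close> by the unit balls around
the points \<open>p\<close> so obtained. The cut body \<open>M\<close> together with the points \<open>p\<close> has diameter at most \<open>1\<close>,
because \<open>x\<^sub>K\<close> is \<open>1\<close>-Lipschitz and the cap is small. Hence it is contained in a body \<open>K'\<close> of
constant width \<open>1\<close>, and \<open>K'\<close> is close to \<open>K\<close>. Since \<open>K'\<close> lies in all the unit balls around the points
\<open>p\<close> and contains \<open>M\<close>, it coincides, inside the interior of \<open>K\<close>, with the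
intersection of finitely many unit balls; and its boundary points with normals in the cap do lie in
the interior of \<open>K\<close>. At such a point either two different unit spheres meet, and no ball in \<open>K'\<close>
touches there, or the boundary is locally a unit sphere, and all tangential radii are \<open>1\<close>. The
restriction to caps is essential: the pieces of the boundary of \<open>K'\<close> opposite to the edges are
of no use, but Baire category requires just one cap at a time.\<close>

section \<open>Bodies of constant width and their support elements\<close>

lemma constant_width_1_bodyD:
  fixes K :: "'a::euclidean_space set"
  assumes "K \<in> bodies_of_constant_width_1"
  shows "compact K" "convex K" "K \<noteq> {}" "closed K" "bounded K"
  using assms compact_imp_closed compact_imp_bounded
  by (auto simp: bodies_of_constant_width_1_def convex_body_def)

lemma constant_width_1_width:
  fixes K :: "'a::euclidean_space set"
  assumes "K \<in> bodies_of_constant_width_1" "norm u = 1"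
  shows "support_fun K u + support_fun K (- u) = 1"
  using assms by (auto simp: bodies_of_constant_width_1_def constant_width_1_def)

lemma support_element_closed_iff:
  fixes K :: "'a::euclidean_space set"
  assumes "closed K"
  shows "support_element K x u \<longleftrightarrow> x \<in> K \<and> outer_unit_normal K x u"
proof -
  have "x \<notin> interior K" if "outer_unit_normal K x u"
  proof
    assume "x \<in> interior K"
    then obtain e where e: "e > 0" "cball x e \<subseteq> K"
      by (auto simp: mem_interior_cball)
    have u: "norm u = 1" "\<forall>y\<in>K. y \<bullet> u \<le> x \<bullet> u"
      using that by (auto simp: outer_unit_normal_def)
    have "x + e *\<^sub>R u \<in> K" using e u by (intro subsetD[OF e(2)]) (simp add: dist_norm)
    then have "(x + e *\<^sub>R u) \<bullet> u \<le> x \<bullet> u" using u by blast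
    moreover have "u \<bullet> u = 1" using u by (simp add: norm_eq_1)
    ultimately show False using e by (simp add: inner_add_left)
  qed
  then show ?thesis
    using assms by (auto simp: support_element_def frontier_def closure_closed)
qed

text \<open>Membership in the unit ball that touches the hyperplane with normal \<open>u\<close> at \<open>x\<close>, in the quadratic
form in which it can be added and compared.\<close>

lemma in_unit_ball_iff:
  fixes x u z :: "'a::euclidean_space"
  assumes "norm u = 1"
  shows "z \<in> cball (x - u) 1 \<longleftrightarrow> (norm (z - x))\<^sup>2 + 2 * ((z - x) \<bullet> u) \<le> 0"
proof -
  have "z \<in> cball (x - u) 1 \<longleftrightarrow> norm ((z - x) + u) \<le> 1"
    by (simp add: dist_norm norm_minus_commute algebra_simps)
  also have "\<dots> \<longleftrightarrow> (norm ((z - x) + u))\<^sup>2 \<le> 1"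
    by (simp add: abs_square_le_1)
  also have "(norm ((z - x) + u))\<^sup>2 = (norm (z - x))\<^sup>2 + 2 * ((z - x) \<bullet> u) + 1"
    using assms by (simp add: power2_norm_eq_inner norm_eq_1 inner_add_left inner_add_right inner_commute)
  finally show ?thesis by simp
qed

lemma constant_width_1_dist_le:
  fixes K :: "'a::euclidean_space set"
  assumes K: "K \<in> bodies_of_constant_width_1" and p: "p \<in> K" and q: "q \<in> K"
  shows "dist p q \<le> 1"
proof (cases "p = q")
  case False
  let ?v = "sgn (p - q)"
  have le: "y \<bullet> v \<le> support_fun K v" if "y \<in> K" for y v
    using support_fun_attained[of K v] constant_width_1_bodyD[OF K] that by auto
  have nv: "norm ?v = 1" using False by (simp add: norm_sgn)
  have "(p - q) \<bullet> ?v = norm (p - q)"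
    using False by (simp add: sgn_div_norm divide_inverse power2_norm_eq_inner[symmetric] power2_eq_square)
  moreover have "(p - q) \<bullet> ?v \<le> 1"
    using constant_width_1_width[OF K nv] le[OF p, of ?v] le[OF q, of "- ?v"]
    by (simp add: inner_diff_left)
  ultimately show ?thesis by (simp add: dist_norm)
qed simp

lemma in_constant_width_1I:
  fixes K :: "'a::euclidean_space set"
  assumes "compact K" "convex K" "K \<noteq> {}"
    and diam: "\<And>p q. p \<in> K \<Longrightarrow> q \<in> K \<Longrightarrow> dist p q \<le> 1"
    and chord: "\<And>u. norm u = 1 \<Longrightarrow> \<exists>x\<in>K. x - u \<in> K"
  shows "K \<in> bodies_of_constant_width_1"
proof -
  have "support_fun K u + support_fun K (- u) = 1" if u: "norm u = 1" for u
  proof -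
    obtain x where x: "x \<in> K" "support_fun K u = x \<bullet> u" "\<forall>y\<in>K. y \<bullet> u \<le> x \<bullet> u"
      using support_fun_attained[OF assms(1,3)] by blast
    obtain z where z: "z \<in> K" "support_fun K (- u) = - (z \<bullet> u)" "\<forall>y\<in>K. z \<bullet> u \<le> y \<bullet> u"
      using support_fun_attained[OF assms(1,3), of "- u"] by auto
    obtain a where a: "a \<in> K" "a - u \<in> K" using chord[OF u] by blast
    have "(x - z) \<bullet> u \<le> norm (x - z) * norm u" by (rule norm_cauchy_schwarz)
    also have "\<dots> \<le> 1" using diam[OF x(1) z(1)] u by (simp add: dist_norm)
    finally have "x \<bullet> u - z \<bullet> u \<le> 1" by (simp add: inner_diff_left)
    moreover have "a \<bullet> u \<le> x \<bullet> u" "z \<bullet> u \<le> (a - u) \<bullet> u" using a x z by auto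
    moreover have "(a - u) \<bullet> u = a \<bullet> u - 1" using u by (simp add: inner_diff_left norm_eq_1)
    ultimately show ?thesis using x z by simp
  qed
  then show ?thesis using assms
    by (auto simp: bodies_of_constant_width_1_def convex_body_def constant_width_1_def)
qed

lemma constant_width_1_support_exists:
  fixes K :: "'a::euclidean_space set"
  assumes "K \<in> bodies_of_constant_width_1" "norm u = 1"
  shows "\<exists>x\<in>K. outer_unit_normal K x u"
  using support_fun_attained[of K u] constant_width_1_bodyD[OF assms(1)] assms(2)
  by (auto simp: outer_unit_normal_def)

text \<open>The support point \<open>z\<close> in direction \<open>- u\<close> satisfies \<open>(x - z) \<bullet> u = 1\<close> and \<open>norm (x - z) \<le> 1\<close>; equality
in the Cauchy-Schwarz inequality forces \<open>x - z = u\<close>.\<close>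

lemma constant_width_1_antipode:
  fixes K :: "'a::euclidean_space set"
  assumes K: "K \<in> bodies_of_constant_width_1" and x: "x \<in> K" "outer_unit_normal K x u"
  shows "x - u \<in> K"
proof -
  have u: "norm u = 1" using x by (simp add: outer_unit_normal_def)
  note c = constant_width_1_bodyD[OF K]
  obtain z where z: "z \<in> K" "support_fun K (- u) = z \<bullet> (- u)"
    using support_fun_attained[OF c(1,3)] by blast
  obtain y where "y \<in> K" "support_fun K u = y \<bullet> u" "\<forall>w\<in>K. w \<bullet> u \<le> y \<bullet> u"
    using support_fun_attained[OF c(1,3)] by blast
  with x have "support_fun K u = x \<bullet> u"
    by (fastforce simp: outer_unit_normal_def)
  then have d: "(x - z) \<bullet> u = 1"
    using constant_width_1_width[OF K u] z by (simp add: inner_diff_left)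
  have "norm (x - z) \<le> 1" using constant_width_1_dist_le[OF K x(1) z(1)] by (simp add: dist_norm)
  then have "(norm (x - z))\<^sup>2 \<le> 1" by (simp add: abs_square_le_1)
  moreover have "(norm ((x - z) - u))\<^sup>2 = (norm (x - z))\<^sup>2 - 2 * ((x - z) \<bullet> u) + (norm u)\<^sup>2"
    by (simp add: power2_norm_eq_inner inner_diff_left inner_diff_right inner_commute)
  ultimately have "(norm ((x - z) - u))\<^sup>2 \<le> 0" using d u by simp
  then have "x - z - u = 0" by simp
  then have "x - u = z" by (simp add: algebra_simps)
  then show ?thesis using z by simp
qed

lemma constant_width_1_in_unit_ball:
  fixes K :: "'a::euclidean_space set"
  assumes K: "K \<in> bodies_of_constant_width_1" and x: "x \<in> K" "outer_unit_normal K x u" and z: "z \<in> K"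
  shows "(norm (z - x))\<^sup>2 + 2 * ((z - x) \<bullet> u) \<le> 0"
  using constant_width_1_dist_le[OF K constant_width_1_antipode[OF K x] z] x
  by (subst in_unit_ball_iff[symmetric]) (simp_all add: outer_unit_normal_def)

text \<open>Each of the two points lies in the unit ball that belongs to the other; the two quadratic
inequalities add up to \<open>(norm (x - y))\<^sup>2 \<le> (x - y) \<bullet> (u - v)\<close>.\<close>

lemma constant_width_1_support_point_Lipschitz:
  fixes K :: "'a::euclidean_space set"
  assumes K: "K \<in> bodies_of_constant_width_1"
    and x: "x \<in> K" "outer_unit_normal K x u" and y: "y \<in> K" "outer_unit_normal K y v"
  shows "dist x y \<le> dist u v"
proof -
  have "(norm (y - x))\<^sup>2 + 2 * ((y - x) \<bullet> u) + ((norm (x - y))\<^sup>2 + 2 * ((x - y) \<bullet> v)) \<le> 0"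
    using constant_width_1_in_unit_ball[OF K x y(1)] constant_width_1_in_unit_ball[OF K y x(1)] by simp
  then have "(norm (x - y))\<^sup>2 \<le> (x - y) \<bullet> (u - v)"
    by (simp add: norm_minus_commute inner_diff_left inner_diff_right)
  also have "\<dots> \<le> norm (x - y) * norm (u - v)" by (rule norm_cauchy_schwarz)
  finally show ?thesis
    by (cases "x = y") (simp_all add: dist_norm power2_eq_square)
qed

lemma inner_ball_unique_normal:
  fixes K :: "'a::euclidean_space set"
  assumes "norm u = 1" "r > 0" "cball (x - r *\<^sub>R u) r \<subseteq> K" and v: "outer_unit_normal K x v"
  shows "v = u"
proof -
  have nv: "norm v = 1" using v by (simp add: outer_unit_normal_def)
  have "x - r *\<^sub>R u + r *\<^sub>R v \<in> K"
    using assms nv by (intro subsetD[OF assms(3)]) (simp add: dist_norm)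
  then have "(x - r *\<^sub>R u + r *\<^sub>R v) \<bullet> v \<le> x \<bullet> v" using v by (simp add: outer_unit_normal_def)
  then have "r * (1 - u \<bullet> v) \<le> 0"
    using nv by (simp add: inner_add_left inner_diff_left norm_eq_1 algebra_simps)
  then have "1 \<le> u \<bullet> v" using \<open>r > 0\<close> by (simp add: mult_le_0_iff)
  moreover have "(norm (v - u))\<^sup>2 = 2 - 2 * (u \<bullet> v)"
    using nv assms(1) by (simp add: power2_norm_eq_inner inner_diff_left inner_diff_right inner_commute norm_eq_1)
  ultimately have "(norm (v - u))\<^sup>2 \<le> 0" by simp
  then show ?thesis by simp
qed

section \<open>Completion\<close>

text \<open>A unit ball containing \<open>x\<close> and \<open>q\<close> contains the short circular arcs of radius \<open>1\<close> between them. The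
chord bulged parabolically in an arbitrary direction \<open>u\<close> is a convenient substitute for these arcs.
It stays in the ball because the squared distance from the centre, restricted to the chord, is
convex with second derivative \<open>2 * (norm (q - x))\<^sup>2\<close>, and because \<open>sqrt (1 - X) \<le> 1 - X / 2\<close>.\<close>

lemma ball_hull_bulge:
  fixes x q c u :: "'a::euclidean_space"
  assumes "dist c x \<le> 1" "dist c q \<le> 1" "norm u = 1" "0 \<le> s" "s \<le> 1"
  shows "dist c (x + s *\<^sub>R (q - x) + (s * (1 - s) * (norm (q - x))\<^sup>2 / 2) *\<^sub>R u) \<le> 1"
proof -
  let ?L = "(norm (q - x))\<^sup>2" and ?a = "x - c" and ?b = "q - c"
  define X where "X = s * (1 - s) * ?L"
  define w where "w = x + s *\<^sub>R (q - x) - c"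
  have X0: "0 \<le> X" using assms by (simp add: X_def)
  have ab: "?L = (norm ?b)\<^sup>2 - 2 * (?a \<bullet> ?b) + (norm ?a)\<^sup>2"
    by (simp add: power2_norm_eq_inner inner_diff_left inner_diff_right inner_commute)
  have w: "w = (1 - s) *\<^sub>R ?a + s *\<^sub>R ?b" by (simp add: w_def algebra_simps)
  have "(norm w)\<^sup>2 = (1 - s)\<^sup>2 * (norm ?a)\<^sup>2 + 2 * (s * (1 - s)) * (?a \<bullet> ?b) + s\<^sup>2 * (norm ?b)\<^sup>2"
    unfolding w power2_norm_eq_inner[of "_ + _"] inner_add_left inner_add_right inner_scaleR_left inner_scaleR_right
      power2_norm_eq_inner[of ?a] power2_norm_eq_inner[of ?b] inner_commute[of ?b ?a]
    by (simp add: power2_eq_square algebra_simps)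
  also have "\<dots> = (1 - s) * (norm ?a)\<^sup>2 + s * (norm ?b)\<^sup>2 - X"
    unfolding X_def ab by (simp add: power2_eq_square algebra_simps)
  also have "\<dots> \<le> (1 - s) * 1 + s * 1 - X"
    using assms by (intro diff_right_mono add_mono mult_left_mono)
      (auto simp: abs_square_le_1 dist_norm norm_minus_commute)
  finally have nw: "(norm w)\<^sup>2 \<le> 1 - X" by simp
  then have X1: "X \<le> 1" using zero_le_power2[of "norm w"] by linarith
  have "1 - X \<le> (1 - X / 2)\<^sup>2" by (simp add: power2_eq_square algebra_simps)
  with nw have "(norm w)\<^sup>2 \<le> (1 - X / 2)\<^sup>2" by simp
  then have "norm w \<le> 1 - X / 2" by (rule power2_le_imp_le) (use X1 in simp)
  moreover have "norm (w + (X / 2) *\<^sub>R u) \<le> norm w + X / 2"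
    using norm_triangle_ineq[of w "(X / 2) *\<^sub>R u"] X0 assms by simp
  moreover have "x + s *\<^sub>R (q - x) + (s * (1 - s) * (norm (q - x))\<^sup>2 / 2) *\<^sub>R u - c = w + (X / 2) *\<^sub>R u"
    by (simp add: w_def X_def)
  ultimately show ?thesis
    by (simp only: dist_norm norm_minus_commute[of c])
qed

text \<open>Meissner's theorem. A maximal set \<open>K\<close> of diameter at most \<open>1\<close> is the intersection of the unit balls
with centres in \<open>K\<close>. If \<open>x\<close> is its support point in direction \<open>u\<close> but some \<open>q \<in> K\<close> lies outside the unit ball
around \<open>x - u\<close>, then the chord from \<open>x\<close> to \<open>q\<close> is so flat that the bulge of the chord in direction
\<open>u\<close> rises above the supporting hyperplane. So \<open>x - u\<close> has distance at most \<open>1\<close> from all of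
\<open>K\<close>, and belongs to \<open>K\<close> by maximality.\<close>

theorem constant_width_1_completion:
  fixes S :: "'a::euclidean_space set"
  assumes S: "S \<noteq> {}" "\<And>p q. p \<in> S \<Longrightarrow> q \<in> S \<Longrightarrow> dist p q \<le> 1"
  shows "\<exists>K \<in> bodies_of_constant_width_1. S \<subseteq> K"
proof -
  define \<A> where "\<A> = {T. S \<subseteq> T \<and> (\<forall>p\<in>T. \<forall>q\<in>T. dist p q \<le> 1)}"
  have "\<exists>K\<in>\<A>. \<forall>T\<in>\<A>. K \<subseteq> T \<longrightarrow> T = K"
  proof (rule subset_Zorn_nonempty)
    show "\<A> \<noteq> {}" using S by (auto simp: \<A>_def)
    fix \<C> assume C: "\<C> \<noteq> {}" "subset.chain \<A> \<C>"
    have "dist p q \<le> 1" if pq: "p \<in> \<Union>\<C>" "q \<in> \<Union>\<C>" for p q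
    proof -
      obtain T U where TU: "T \<in> \<C>" "U \<in> \<C>" "p \<in> T" "q \<in> U" using pq by blast
      then have "T \<subseteq> U \<or> U \<subseteq> T" "T \<in> \<A>" "U \<in> \<A>"
        using C by (auto simp: subset.chain_def subset_chain_def)
      then show ?thesis using TU by (auto simp: \<A>_def)
    qed
    moreover obtain T where "T \<in> \<C>" "T \<in> \<A>" using C by (auto simp: subset_chain_def)
    ultimately show "\<Union>\<C> \<in> \<A>" by (auto simp: \<A>_def)
  qed
  then obtain K where KA: "K \<in> \<A>" and maxK: "\<forall>T\<in>\<A>. K \<subseteq> T \<longrightarrow> T = K"
    by (rule bexE)
  have K: "S \<subseteq> K" "\<And>p q. p \<in> K \<Longrightarrow> q \<in> K \<Longrightarrow> dist p q \<le> 1"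
    using KA by (simp_all add: \<A>_def)
  have in_KI: "z \<in> K" if z: "\<And>q. q \<in> K \<Longrightarrow> dist q z \<le> 1" for z
  proof -
    have "dist p q \<le> 1" if "p \<in> insert z K" "q \<in> insert z K" for p q
      using that z K(2) by (auto simp: dist_commute)
    then have "insert z K \<in> \<A>" using K(1) by (auto simp: \<A>_def)
    then have "insert z K = K" using maxK by (simp add: subset_insertI)
    then show ?thesis by (metis insertI1)
  qed
  have K_balls: "K = (\<Inter>q\<in>K. cball q 1)"
    by (intro equalityI subsetI) (auto intro: K(2) in_KI)
  have ne: "K \<noteq> {}" using K(1) S(1) by (metis subset_empty)
  have "closed (\<Inter>q\<in>K. cball q 1)" "convex (\<Inter>q\<in>K. cball q 1)"
    by (intro closed_INT convex_INT ballI closed_cball convex_cball)+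
  then have clo: "closed K" and conv: "convex K" by (metis K_balls)+
  obtain k where k: "k \<in> K" using ne by (metis ex_in_conv)
  have "K \<subseteq> cball k 1" using K(2)[OF k] by auto
  then have comp: "compact K" using clo by (metis bounded_cball bounded_subset compact_eq_bounded_closed)
  have "\<exists>x\<in>K. x - u \<in> K" if u: "norm u = 1" for u
  proof -
    obtain x where x: "x \<in> K" "\<And>y. y \<in> K \<Longrightarrow> y \<bullet> u \<le> x \<bullet> u"
      using support_fun_attained[OF comp ne] by blast
    have "q \<in> cball (x - u) 1" if q: "q \<in> K" for q
    proof (rule ccontr)
      let ?e = "q - x"
      assume "q \<notin> cball (x - u) 1"
      then have D: "0 < (norm ?e)\<^sup>2 + 2 * (?e \<bullet> u)" using in_unit_ball_iff[OF u] by force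
      define D where "D = (norm ?e)\<^sup>2 + 2 * (?e \<bullet> u)"
      have D0: "D > 0" using D by (simp add: D_def)
      \<comment> \<open>The bulge point with parameter \<open>s\<close> has height \<open>s * (D - s * (norm ?e)\<^sup>2) / 2\<close> over the supporting
        hyperplane, which is positive for small \<open>s\<close>.\<close>
      define s where "s = min 1 (D / (2 * ((norm ?e)\<^sup>2 + 1)))"
      have pos: "(norm ?e)\<^sup>2 + 1 > 0" by (simp add: add_nonneg_pos)
      have s: "0 < s" "s \<le> 1" "s * (norm ?e)\<^sup>2 < D"
      proof -
        show "0 < s" using D0 pos by (simp add: s_def)
        show "s \<le> 1" by (simp add: s_def)
        have "s * (norm ?e)\<^sup>2 \<le> (D / (2 * ((norm ?e)\<^sup>2 + 1))) * ((norm ?e)\<^sup>2 + 1)"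
          using D0 pos by (intro mult_mono) (auto simp: s_def)
        also have "\<dots> = D / 2" using pos by (simp add: field_simps)
        also have "\<dots> < D" using D0 by simp
        finally show "s * (norm ?e)\<^sup>2 < D" .
      qed
      let ?z = "x + s *\<^sub>R ?e + (s * (1 - s) * (norm ?e)\<^sup>2 / 2) *\<^sub>R u"
      have "?z \<in> K"
      proof (rule in_KI)
        fix k assume k: "k \<in> K"
        show "dist k ?z \<le> 1"
          using s u by (intro ball_hull_bulge K(2)[OF k x(1)] K(2)[OF k q]) auto
      qed
      then have "?z \<bullet> u \<le> x \<bullet> u" using x by blast
      then have "s * (?e \<bullet> u) + s * (1 - s) * (norm ?e)\<^sup>2 / 2 \<le> 0"
        using u by (simp add: inner_add_left norm_eq_1)
      also have "s * (?e \<bullet> u) + s * (1 - s) * (norm ?e)\<^sup>2 / 2 = s * (D - s * (norm ?e)\<^sup>2) / 2"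
        by (simp add: D_def field_simps)
      finally show False using s by (simp add: mult_le_0_iff)
    qed
    then have "x - u \<in> K" by (intro in_KI[of "x - u"]) (simp add: dist_commute)
    with x(1) show ?thesis by (rule bexI[rotated])
  qed
  then have "K \<in> bodies_of_constant_width_1"
    by (intro in_constant_width_1I comp conv ne K(2))
  with K(1) show ?thesis by (rule bexI)
qed

section \<open>Smoothing\<close>

text \<open>The body \<open>(1 - 2 r) K + r B\<close>, where \<open>B\<close> is the unit ball, has constant width \<open>1\<close> again, and each
of its boundary points is touched from inside by a ball of radius \<open>r\<close>.\<close>

lemma constant_width_1_smoothing:
  fixes K :: "'a::euclidean_space set"
  assumes K: "K \<in> bodies_of_constant_width_1" and e: "e > 0"
  shows "\<exists>K'\<in>bodies_of_constant_width_1. hausdorff_dist K' K \<le> e \<and>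
    (\<exists>r>0. \<forall>x u. x \<in> K' \<and> outer_unit_normal K' x u \<longrightarrow> cball (x - r *\<^sub>R u) r \<subseteq> K')"
proof -
  note c = constant_width_1_bodyD[OF K]
  obtain R where R: "R > 0" "\<And>x. x \<in> K \<Longrightarrow> norm x \<le> R"
    using c(5) bounded_pos by blast
  define r where "r = min (1/2) (e / (2 * (R + 1)))"
  have r: "0 < r" "2 * r \<le> 1" "2 * r * (R + 1) \<le> e"
  proof -
    show "0 < r" "2 * r \<le> 1" using e R by (auto simp: r_def)
    have "2 * r * (R + 1) \<le> 2 * (e / (2 * (R + 1))) * (R + 1)"
      using R by (intro mult_right_mono mult_left_mono) (auto simp: r_def)
    also have "\<dots> = e" using R by (simp add: field_simps)
    finally show "2 * r * (R + 1) \<le> e" .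
  qed
  define f :: "'a \<times> 'a \<Rightarrow> 'a" where "f = (\<lambda>p. (1 - 2 * r) *\<^sub>R fst p + snd p)"
  define K' where "K' = f ` (K \<times> cball 0 r)"
  have K'I: "(1 - 2 * r) *\<^sub>R a + b \<in> K'" if "a \<in> K" "norm b \<le> r" for a b
    using that by (force simp: K'_def f_def)
  have K'E: "\<exists>a b. a \<in> K \<and> norm b \<le> r \<and> z = (1 - 2 * r) *\<^sub>R a + b" if "z \<in> K'" for z
    using that by (force simp: K'_def f_def)
  have lin: "linear f" by (auto simp: f_def linear_iff algebra_simps)
  have W: "K' \<in> bodies_of_constant_width_1"
  proof (rule in_constant_width_1I)
    show "compact K'" unfolding K'_def using lin c
      by (intro compact_continuous_image compact_Times linear_continuous_on) (auto simp: linear_conv_bounded_linear)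
    show "convex K'" unfolding K'_def
      by (rule convex_linear_image[OF lin]) (intro convex_Times c convex_cball)
    show "K' \<noteq> {}" using c(3) r by (auto simp: K'_def)
    show "dist p q \<le> 1" if pq: "p \<in> K'" "q \<in> K'" for p q
    proof -
      obtain a b a' b' where ab: "a \<in> K" "norm b \<le> r" "p = (1 - 2 * r) *\<^sub>R a + b"
        "a' \<in> K" "norm b' \<le> r" "q = (1 - 2 * r) *\<^sub>R a' + b'"
        using K'E[OF pq(1)] K'E[OF pq(2)] by blast
      have "dist p q = norm ((1 - 2 * r) *\<^sub>R (a - a') + (b - b'))"
        unfolding ab(3,6) by (simp add: dist_norm algebra_simps)
      also have "\<dots> \<le> (1 - 2 * r) * dist a a' + (norm b + norm b')"
        using r norm_triangle_ineq[of "(1 - 2 * r) *\<^sub>R (a - a')" "b - b'"] norm_triangle_ineq4[of b b']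
        by (simp add: dist_norm)
      also have "\<dots> \<le> (1 - 2 * r) * 1 + (r + r)"
        using r ab constant_width_1_dist_le[OF K] by (intro add_mono mult_left_mono) auto
      finally show ?thesis by simp
    qed
    show "\<exists>x\<in>K'. x - u \<in> K'" if u: "norm u = 1" for u
    proof -
      obtain x where x: "x \<in> K" "outer_unit_normal K x u"
        using constant_width_1_support_exists[OF K u] by blast
      have "(1 - 2 * r) *\<^sub>R x + r *\<^sub>R u \<in> K'" "(1 - 2 * r) *\<^sub>R (x - u) + (- r) *\<^sub>R u \<in> K'"
        using x u r constant_width_1_antipode[OF K x] by (intro K'I; simp)+
      moreover have "(1 - 2 * r) *\<^sub>R (x - u) + (- r) *\<^sub>R u = (1 - 2 * r) *\<^sub>R x + r *\<^sub>R u - u"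
        by (simp add: algebra_simps flip: scaleR_add_left)
      ultimately show ?thesis by metis
    qed
  qed
  moreover have "hausdorff_dist K' K \<le> e"
  proof -
    have near: "dist ((1 - 2 * r) *\<^sub>R a + b) a \<le> e" if "a \<in> K" "norm b \<le> r" for a b
    proof -
      have "dist ((1 - 2 * r) *\<^sub>R a + b) a = norm (b - (2 * r) *\<^sub>R a)"
        by (simp add: dist_norm algebra_simps)
      also have "\<dots> \<le> r + 2 * r * R"
        using norm_triangle_ineq4[of b "(2 * r) *\<^sub>R a"] that r R(2)[OF that(1)]
        by (smt (verit) mult_left_mono norm_scaleR abs_of_nonneg)
      also have "\<dots> \<le> 2 * r * (R + 1)" using r by (simp add: algebra_simps)
      finally show ?thesis using r by simp
    qed
    have "infdist z K \<le> e" if "z \<in> K'" for z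
      using K'E[OF that] near by (metis infdist_le2)
    moreover have "infdist a K' \<le> e" if "a \<in> K" for a
      using near[OF that, of 0] K'I[OF that, of 0] r
      by (metis dist_commute infdist_le2 less_imp_le norm_zero)
    ultimately show ?thesis
      using hausdorff_dist_le_iff[of K' K e] c constant_width_1_bodyD[OF W] by blast
  qed
  moreover have "cball (x - r *\<^sub>R u) r \<subseteq> K'" if x: "x \<in> K'" "outer_unit_normal K' x u" for x u
  proof -
    obtain a b where ab: "a \<in> K" "norm b \<le> r" "x = (1 - 2 * r) *\<^sub>R a + b"
      using K'E[OF x(1)] by blast
    have u: "norm u = 1" "u \<bullet> u = 1" using x by (auto simp: outer_unit_normal_def norm_eq_1)
    \<comment> \<open>Maximality of \<open>x\<close> in direction \<open>u\<close> forces its ball component \<open>b\<close> to be \<open>r u\<close>.\<close>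
    have "((1 - 2 * r) *\<^sub>R a + r *\<^sub>R u) \<bullet> u \<le> x \<bullet> u"
      using x(2) K'I[OF ab(1), of "r *\<^sub>R u"] u r by (auto simp: outer_unit_normal_def)
    then have "r \<le> b \<bullet> u" using ab u by (simp add: inner_add_left)
    moreover have "(norm (b - r *\<^sub>R u))\<^sup>2 = (norm b)\<^sup>2 - 2 * r * (b \<bullet> u) + r\<^sup>2"
      unfolding power2_norm_eq_inner using u
      by (simp add: inner_diff_left inner_diff_right inner_commute power2_eq_square algebra_simps)
    moreover have "(norm b)\<^sup>2 \<le> r\<^sup>2" using ab by (intro power_mono) auto
    moreover have "2 * r * r \<le> 2 * r * (b \<bullet> u)" using \<open>r \<le> b \<bullet> u\<close> r by (intro mult_left_mono) auto
    ultimately have "(norm (b - r *\<^sub>R u))\<^sup>2 \<le> 0" by (simp add: power2_eq_square)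
    then have centre: "x - r *\<^sub>R u = (1 - 2 * r) *\<^sub>R a" using ab by simp
    show ?thesis
    proof
      fix y assume "y \<in> cball (x - r *\<^sub>R u) r"
      then have "norm (y - (1 - 2 * r) *\<^sub>R a) \<le> r"
        by (simp add: centre dist_norm norm_minus_commute)
      from K'I[OF ab(1) this] show "y \<in> K'" by simp
    qed
  qed
  ultimately show ?thesis using r by blast
qed

section \<open>Replacing a piece of the boundary by spherical facets\<close>

lemma in_interior_if_strictly_supported:
  fixes K :: "'a::euclidean_space set"
  assumes "convex K" "interior K \<noteq> {}"
    and strict: "\<And>w. norm w = 1 \<Longrightarrow> \<exists>y\<in>K. q \<bullet> w < y \<bullet> w"
  shows "q \<in> interior K"
proof (rule ccontr)
  assume "q \<notin> interior K"
  then obtain a b where ab: "a \<noteq> 0" "\<forall>x\<in>interior K. a \<bullet> x \<le> b" "b \<le> a \<bullet> q"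
    using separating_hyperplane_sets[of "interior K" "{q}"] assms(1,2) by auto
  have "closure (interior K) \<subseteq> {x. a \<bullet> x \<le> b}"
    using ab by (intro closure_minimal closed_halfspace_le) auto
  then have "\<forall>y\<in>K. a \<bullet> y \<le> b"
    using convex_closure_interior[OF assms(1,2)] closure_subset[of K] by blast
  moreover obtain y where "y \<in> K" "q \<bullet> sgn a < y \<bullet> sgn a"
    using strict[of "sgn a"] ab by (auto simp: norm_sgn)
  then have "y \<in> K" "a \<bullet> q < a \<bullet> y"
    using ab by (simp_all add: sgn_div_norm inner_commute divide_strict_right_mono)
  ultimately show False using ab by force
qed

lemma constant_width_1_antipode_normal:
  fixes K :: "'a::euclidean_space set"
  assumes K: "K \<in> bodies_of_constant_width_1" and x: "x \<in> K" "outer_unit_normal K x u"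
  shows "outer_unit_normal K (x - u) (- u)"
proof -
  have u: "norm u = 1" using x by (simp add: outer_unit_normal_def)
  have "- (y \<bullet> u) \<le> 1 - x \<bullet> u" if "y \<in> K" for y
    using norm_cauchy_schwarz[of "x - y" u] constant_width_1_dist_le[OF K x(1) that] u
    by (simp add: dist_norm inner_diff_left)
  then show ?thesis using u
    by (simp add: outer_unit_normal_def inner_diff_left norm_eq_1)
qed

text \<open>The caps \<open>dist u d \<le> 1/8\<close> of normals are so small that the cutting balls, whose
normals come from the cap of twice the radius, have centres with mutual distances at most \<open>1\<close>. The hypothesis that a ball inside \<open>K'\<close>
touches at \<open>x\<close> excludes the points where several of the cutting spheres meet.\<close>

theorem locally_spherical_approximation:
  fixes K :: "'a::euclidean_space set"
  assumes K: "K \<in> bodies_of_constant_width_1" and e: "e > 0" and r: "r > 0"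
    and ball: "\<And>x u. x \<in> K \<Longrightarrow> outer_unit_normal K x u \<Longrightarrow> cball (x - r *\<^sub>R u) r \<subseteq> K"
  shows "\<exists>K'\<in>bodies_of_constant_width_1. hausdorff_dist K' K \<le> e \<and>
    (\<forall>x u s. x \<in> K' \<longrightarrow> outer_unit_normal K' x u \<longrightarrow> dist u d \<le> 1/8 \<longrightarrow>
        s > 0 \<longrightarrow> cball (x - s *\<^sub>R u) s \<subseteq> K' \<longrightarrow>
      (\<exists>\<epsilon>>0. cball (x - u) 1 \<inter> ball x \<epsilon> \<subseteq> K'))"
proof -
  note c = constant_width_1_bodyD[OF K]
  \<comment> \<open>The outward shift of the added points. The bodies \<open>K\<close> and \<open>K'\<close> will have distance at most
    \<open>8 * \<delta>\<close>; the last bound makes their support points so close that the touching balls of radius \<open>r\<close> in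
    \<open>K\<close> control all directions far from \<open>u\<close>.\<close>
  define \<delta> where "\<delta> = min (1/16) (min (e / 8) ((r / 128)\<^sup>2 / 40))"
  have \<delta>: "0 < \<delta>" "\<delta> \<le> 1/16" "8 * \<delta> \<le> e" "40 * \<delta> \<le> (r / 128)\<^sup>2"
    using e r by (auto simp: \<delta>_def min_def)
  have "\<forall>u. \<exists>x. norm u = 1 \<longrightarrow> x \<in> K \<and> outer_unit_normal K x u"
    using constant_width_1_support_exists[OF K] by blast
  then obtain X where X: "\<And>u. norm u = 1 \<Longrightarrow> X u \<in> K" "\<And>u. norm u = 1 \<Longrightarrow> outer_unit_normal K (X u) u"
    by metis
  have Xmax: "y \<bullet> u \<le> X u \<bullet> u" if "y \<in> K" "norm u = 1" for y u
    using X(2)[OF that(2)] that by (simp add: outer_unit_normal_def)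
  define C :: "'a set" where "C = sphere 0 1 \<inter> cball d (1/4)"
  have "compact C" by (simp add: C_def compact_Int_closed)
  then obtain G where G: "finite G" "G \<subseteq> C" "C \<subseteq> (\<Union>v\<in>G. ball v (sqrt \<delta>))"
    using seq_compact_imp_totally_bounded[OF compact_imp_seq_compact, of C] \<delta>(1) real_sqrt_gt_zero by metis
  have Gn: "norm v = 1" "dist d v \<le> 1/4" if "v \<in> G" for v
    using that G(2) by (auto simp: C_def)
  \<comment> \<open>Shifts of the points \<open>X v - v\<close> of \<open>K\<close> opposite to \<open>X v\<close>, outwards by \<open>\<delta>\<close>.\<close>
  define p where "p = (\<lambda>v. X v - (1 + \<delta>) *\<^sub>R v)"
  have p_near: "dist (p v) (X v - v) = \<delta>" if "v \<in> G" for v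
    using Gn[OF that] \<delta>(1) by (simp add: p_def dist_norm algebra_simps)
  have antip: "X v - v \<in> K" if "norm v = 1" for v
    using constant_width_1_antipode[OF K X(1) X(2)] that by blast
  define M where "M = K \<inter> (\<Inter>v\<in>G. cball (p v) 1)"
  obtain u0 :: 'a where u0: "norm u0 = 1" using norm_Basis nonempty_Basis by blast
  \<comment> \<open>The midpoint of a diameter. Its distance from all points of \<open>K\<close> is bounded away from \<open>1\<close>, so moving
    points of \<open>K\<close> a little towards it brings them into all the cutting balls.\<close>
  define o' where "o' = X u0 - (1/2) *\<^sub>R u0"
  have o'K: "o' \<in> K"
    using convexD[OF c(2) X(1)[OF u0] antip[OF u0], of "1/2" "1/2"]
    by (simp add: o'_def algebra_simps flip: scaleR_add_left)
  have o'_dist: "dist z o' \<le> 7/8" if z: "z \<in> K" for z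
  proof -
    have "(norm (z - o'))\<^sup>2 = (norm (z - X u0 + (1/2) *\<^sub>R u0))\<^sup>2"
      by (simp add: o'_def algebra_simps)
    also have "\<dots> = (norm (z - X u0))\<^sup>2 + (z - X u0) \<bullet> u0 + 1/4"
      using u0 by (simp add: power2_norm_eq_inner norm_eq_1 inner_add_left inner_add_right inner_commute)
    also have "\<dots> \<le> (norm (z - X u0))\<^sup>2 / 2 + 1/4"
      using constant_width_1_in_unit_ball[OF K X(1)[OF u0] X(2)[OF u0] z] by simp
    also have "\<dots> \<le> 1 / 2 + 1/4"
      using constant_width_1_dist_le[OF K z X(1)[OF u0]]
      by (intro add_right_mono divide_right_mono) (auto simp: abs_square_le_1 dist_norm)
    also have "\<dots> \<le> (7/8)\<^sup>2" by (simp add: power2_eq_square)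
    finally show ?thesis unfolding dist_norm by (rule power2_le_imp_le) simp
  qed
  have M_near: "\<exists>m\<in>M. dist z m \<le> 8 * \<delta>" if z: "z \<in> K" for z
  proof
    let ?m = "(1 - 8 * \<delta>) *\<^sub>R z + (8 * \<delta>) *\<^sub>R o'"
    have "?m \<in> K" using c(2) z o'K \<delta> by (intro convexD) auto
    moreover have "dist (p v) ?m \<le> 1" if v: "v \<in> G" for v
    proof -
      have 1: "dist (p v) z \<le> 1 + \<delta>"
        using dist_triangle[of "p v" z "X v - v"] p_near[OF v]
          constant_width_1_dist_le[OF K antip z] Gn[OF v] by fastforce
      have 2: "dist (p v) o' \<le> 7/8 + \<delta>"
        using dist_triangle[of "p v" o' "X v - v"] p_near[OF v] o'_dist[OF antip] Gn[OF v] by fastforce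
      have "p v - ?m = (1 - 8 * \<delta>) *\<^sub>R (p v - z) + (8 * \<delta>) *\<^sub>R (p v - o')"
        by (simp add: algebra_simps)
      then have "dist (p v) ?m \<le> (1 - 8 * \<delta>) * dist (p v) z + (8 * \<delta>) * dist (p v) o'"
        using norm_triangle_ineq[of "(1 - 8 * \<delta>) *\<^sub>R (p v - z)" "(8 * \<delta>) *\<^sub>R (p v - o')"] \<delta>
        by (simp add: dist_norm)
      also have "\<dots> \<le> (1 - 8 * \<delta>) * (1 + \<delta>) + (8 * \<delta>) * (7/8 + \<delta>)"
        using 1 2 \<delta> by (intro add_mono mult_left_mono) auto
      also have "\<dots> = 1" by (simp add: algebra_simps)
      finally show ?thesis .
    qed
    ultimately show "?m \<in> M" by (simp add: M_def)
    have "dist z ?m = 8 * \<delta> * dist z o'"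
    proof -
      have "z - ?m = (8 * \<delta>) *\<^sub>R (z - o')" by (simp add: algebra_simps)
      then show ?thesis using \<delta> by (simp add: dist_norm)
    qed
    also have "\<dots> \<le> 8 * \<delta> * 1" using o'_dist[OF z] \<delta> by (intro mult_left_mono) auto
    finally show "dist z ?m \<le> 8 * \<delta>" by simp
  qed
  have pp: "dist (p v) (p w) \<le> 1" if v: "v \<in> G" and w: "w \<in> G" for v w
  proof -
    have "p v - p w = ((X v - v) - (X w - w)) - \<delta> *\<^sub>R (v - w)"
      by (simp add: p_def algebra_simps)
    then have "dist (p v) (p w) \<le> dist (X v - v) (X w - w) + \<delta> * dist v w"
      using norm_triangle_ineq4[of "(X v - v) - (X w - w)" "\<delta> *\<^sub>R (v - w)"] \<delta> by (simp add: dist_norm)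
    also have "dist (X v - v) (X w - w) \<le> dist (- v) (- w)"
      using Gn[OF v] Gn[OF w] K X antip
      by (intro constant_width_1_support_point_Lipschitz[of K] constant_width_1_antipode_normal[of K])
    also have "dist (- v) (- w) = dist v w" by (simp add: dist_norm norm_minus_commute)
    also have "dist v w + \<delta> * dist v w \<le> 1/2 + 1 * (1/2)"
      using dist_triangle2[of v w d] Gn[OF v] Gn[OF w] \<delta>
      by (intro add_mono mult_mono) (auto simp: dist_commute)
    finally show ?thesis by simp
  qed
  obtain K' where K': "K' \<in> bodies_of_constant_width_1" "M \<union> p ` G \<subseteq> K'"
  proof -
    have "dist a b \<le> 1" if "a \<in> M \<union> p ` G" "b \<in> M \<union> p ` G" for a b
      using that pp constant_width_1_dist_le[OF K] by (auto simp: M_def dist_commute)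
    moreover have "M \<union> p ` G \<noteq> {}" using M_near[OF o'K] by blast
    ultimately show ?thesis using constant_width_1_completion[of "M \<union> p ` G"] that by blast
  qed
  note c' = constant_width_1_bodyD[OF K'(1)]
  note d' = constant_width_1_dist_le[OF K'(1)]
  have MK': "m \<in> K'" if "m \<in> M" for m using that K'(2) by blast
  have pK': "dist (p v) q \<le> 1" if "v \<in> G" "q \<in> K'" for v q
    using that K'(2) d' by auto
  have "hausdorff_dist K' K \<le> 8 * \<delta>"
  proof -
    have "infdist z K' \<le> 8 * \<delta>" if "z \<in> K" for z
      using M_near[OF that] MK' infdist_le2 by metis
    moreover have "infdist q K \<le> 8 * \<delta>" if q: "q \<in> K'" for q
    proof (cases "q \<in> K")
      case False
      define z where "z = closest_point K q"
      have z: "z \<in> K" using closest_point_in_set c by (auto simp: z_def)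
      \<comment> \<open>\<open>q\<close> sticks out of \<open>K\<close> over the boundary point \<open>z\<close> with normal \<open>w\<close>. A point of \<open>M\<close> near
        \<open>z - w\<close> has distance at most \<open>1\<close> from \<open>q\<close>, which bounds the excess.\<close>
      define w where "w = sgn (q - z)"
      have ne: "q - z \<noteq> 0" using z False by auto
      have w: "norm w = 1" "q - z = norm (q - z) *\<^sub>R w"
        using ne by (auto simp: w_def norm_sgn sgn_div_norm)
      have "(y - z) \<bullet> w \<le> 0" if "y \<in> K" for y
        using closest_point_dot[OF c(2) c(4) that, of q] ne
        by (simp add: w_def z_def[symmetric] sgn_div_norm inner_commute mult_nonneg_nonpos)
      then have "outer_unit_normal K z w"
        using w by (auto simp: outer_unit_normal_def inner_diff_left)
      then have "z - w \<in> K" using constant_width_1_antipode[OF K z] by blast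
      then obtain m where m: "m \<in> M" "dist (z - w) m \<le> 8 * \<delta>" using M_near by blast
      have "q - (z - w) = (norm (q - z) + 1) *\<^sub>R w" using w(2) by (simp add: algebra_simps)
      then have "norm (q - z) + 1 = dist q (z - w)" using w(1) by (simp add: dist_norm)
      also have "dist q (z - w) \<le> dist q m + dist (z - w) m"
        by (rule dist_triangle2)
      also have "\<dots> \<le> 1 + 8 * \<delta>" using d'[OF q MK'[OF m(1)]] m by simp
      finally have "dist q z \<le> 8 * \<delta>" by (simp add: dist_norm)
      then show ?thesis using z by (meson infdist_le2)
    qed (use \<delta> in simp)
    ultimately show ?thesis using hausdorff_dist_le_iff[of K' K] c c' by blast
  qed
  moreover have "\<exists>\<epsilon>>0. cball (q - u) 1 \<inter> ball q \<epsilon> \<subseteq> K'"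
    if q: "q \<in> K'" "outer_unit_normal K' q u" and ud: "dist u d \<le> 1/8"
      and s: "s > 0" "cball (q - s *\<^sub>R u) s \<subseteq> K'" for q u s
  proof -
    have u: "norm u = 1" using q by (simp add: outer_unit_normal_def)
    have close: "norm (q - X u) \<le> r / 128"
    proof -
      obtain m where m: "m \<in> M" "dist (X u - u) m \<le> 8 * \<delta>" using M_near antip[OF u] by blast
      have "norm (q - X u + u) = dist q (X u - u)" by (simp add: dist_norm algebra_simps)
      also have "\<dots> \<le> dist q m + dist (X u - u) m" by (rule dist_triangle2)
      also have "\<dots> \<le> 1 + 8 * \<delta>" using d'[OF q(1) MK'[OF m(1)]] m by simp
      finally have "(norm (q - X u + u))\<^sup>2 \<le> (1 + 8 * \<delta>)\<^sup>2" by (intro power_mono) auto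
      moreover have "(norm (q - X u + u))\<^sup>2 = (norm (q - X u))\<^sup>2 + 2 * ((q - X u) \<bullet> u) + 1"
        using u by (simp add: power2_norm_eq_inner norm_eq_1 inner_add_left inner_add_right inner_commute)
      moreover obtain m' where m': "m' \<in> M" "dist (X u) m' \<le> 8 * \<delta>" using M_near X(1)[OF u] by blast
      have "m' \<bullet> u \<le> q \<bullet> u" using q(2) MK'[OF m'(1)] by (simp add: outer_unit_normal_def)
      moreover have "(X u - m') \<bullet> u \<le> 8 * \<delta>"
        using norm_cauchy_schwarz[of "X u - m'" u] m' u by (simp add: dist_norm)
      ultimately have "(norm (q - X u))\<^sup>2 \<le> 2 * (8 * \<delta>) + (1 + 8 * \<delta>)\<^sup>2 - 1"
        by (simp add: inner_diff_left)
      also have "\<dots> = 32 * \<delta> + 64 * (\<delta> * \<delta>)" by (simp add: power2_eq_square algebra_simps)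
      also have "64 * (\<delta> * \<delta>) \<le> 64 * (1/16 * \<delta>)" using \<delta> by (intro mult_left_mono mult_right_mono) auto
      finally have "(norm (q - X u))\<^sup>2 \<le> (r / 128)\<^sup>2" using \<delta> by simp
      then show ?thesis by (rule power2_le_imp_le) (use r in simp)
    qed
    have nn: "(norm (v - w))\<^sup>2 = 2 - 2 * (v \<bullet> w)" if "norm v = 1" "norm w = 1" for v w :: 'a
      using that by (simp add: power2_norm_eq_inner inner_diff_left inner_diff_right inner_commute norm_eq_1)
    have "q \<in> interior K"
    proof (rule in_interior_if_strictly_supported[OF c(2)])
      have "ball (X u - r *\<^sub>R u) r \<subseteq> K" using ball[OF X(1)[OF u] X(2)[OF u]] by force
      then have "ball (X u - r *\<^sub>R u) r \<subseteq> interior K" by (rule interior_maximal) (rule open_ball)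
      moreover have "X u - r *\<^sub>R u \<in> ball (X u - r *\<^sub>R u) r" using r by simp
      ultimately show "interior K \<noteq> {}" by (metis empty_iff subsetD)
    next
      fix w :: 'a assume w: "norm w = 1"
      have "q \<bullet> w < X w \<bullet> w"
      \<comment> \<open>Near \<open>u\<close> the cutting balls push \<open>K'\<close> strictly below the supporting hyperplanes of \<open>K\<close>;
        this is where the mesh \<open>sqrt \<delta>\<close> is fine enough. For \<open>w\<close> far from \<open>u\<close>, smoothness of \<open>K\<close> at \<open>X u\<close>
        leaves a gap of more than \<open>r / 128\<close>.\<close>
      proof (cases "dist u w \<le> 1/8")
        case True
        then have "w \<in> C" using ud w dist_triangle[of d w u] by (simp add: C_def dist_commute)
        then obtain v where v: "v \<in> G" "dist v w < sqrt \<delta>" using G(3) by auto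
        then have "(norm (v - w))\<^sup>2 < (sqrt \<delta>)\<^sup>2" by (intro power_strict_mono) (auto simp: dist_norm)
        then have vw: "1 - \<delta> / 2 < v \<bullet> w" using nn[of v w] Gn[OF v(1)] w \<delta> by simp
        have "(q - p v) \<bullet> w \<le> 1"
          using norm_cauchy_schwarz[of "q - p v" w] pK'[OF v(1) q(1)] w by (simp add: dist_norm norm_minus_commute)
        then have "q \<bullet> w \<le> 1 + X v \<bullet> w - (1 + \<delta>) * (v \<bullet> w)" by (simp add: p_def inner_diff_left algebra_simps)
        moreover have "(1 + \<delta>) * (1 - \<delta> / 2) < (1 + \<delta>) * (v \<bullet> w)" using vw \<delta> by (intro mult_strict_left_mono) auto
        moreover have "X v \<bullet> w \<le> X w \<bullet> w" using Xmax X(1) Gn v w by blast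
        moreover have "(1 + \<delta>) * (1 - \<delta> / 2) = 1 + \<delta> * (1 - \<delta>) / 2" by (simp add: field_simps)
        moreover have "0 \<le> \<delta> * (1 - \<delta>) / 2" using \<delta> by simp
        ultimately show ?thesis by linarith
      next
        case False
        then have "(1/8)\<^sup>2 < (norm (u - w))\<^sup>2" by (intro power_strict_mono) (auto simp: dist_norm)
        then have uw: "u \<bullet> w < 1 - 1/128" using nn[OF u w] by (simp add: power2_eq_square)
        have "X u - r *\<^sub>R u + r *\<^sub>R w \<in> K"
          using r w by (intro subsetD[OF ball[OF X(1)[OF u] X(2)[OF u]]]) (simp add: dist_norm)
        from Xmax[OF this w] have "X u \<bullet> w + r * (1 - u \<bullet> w) \<le> X w \<bullet> w"
          using w by (simp add: inner_add_left inner_diff_left norm_eq_1 algebra_simps)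
        moreover have "r * (1/128) < r * (1 - u \<bullet> w)" using uw r by (intro mult_strict_left_mono) auto
        moreover have "(q - X u) \<bullet> w \<le> r / 128"
          using norm_cauchy_schwarz[of "q - X u" w] close w by simp
        ultimately show ?thesis by (simp add: inner_diff_left)
      qed
      then show "\<exists>y\<in>K. q \<bullet> w < y \<bullet> w" using X(1)[OF w] by blast
    qed
    \<comment> \<open>If \<open>q\<close> lies on the cutting sphere around \<open>p v\<close>, then \<open>q - p v\<close> is a normal of \<open>K'\<close> at \<open>q\<close>, and there is
      just one. So at most one cutting sphere passes through \<open>q\<close>.\<close>
    have active: "p v = q - u" if v: "v \<in> G" "\<not> dist (p v) q < 1" for v
    proof -
      have n1: "norm (q - p v) = 1" using v pK'[OF v(1) q(1)] by (simp add: dist_norm norm_minus_commute)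
      have "(y - q) \<bullet> (q - p v) \<le> 0" if y: "y \<in> K'" for y
        using norm_cauchy_schwarz[of "y - p v" "q - p v"] pK'[OF v(1) y] n1
        by (simp add: dist_norm norm_minus_commute norm_eq_1 inner_diff_left)
      then have "outer_unit_normal K' q (q - p v)"
        using n1 by (auto simp: outer_unit_normal_def inner_diff_left)
      from inner_ball_unique_normal[OF u s this] show ?thesis by (simp add: algebra_simps)
    qed
    define U where "U = interior K \<inter> (\<Inter>v\<in>{v\<in>G. dist (p v) q < 1}. ball (p v) 1)"
    have "open U" "q \<in> U"
      using G(1) \<open>q \<in> interior K\<close> by (auto simp: U_def intro!: open_Int open_INT)
    then obtain \<epsilon> where \<epsilon>: "\<epsilon> > 0" "ball q \<epsilon> \<subseteq> U" by (meson openE)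
    have "cball (q - u) 1 \<inter> U \<subseteq> M"
    proof
      fix y assume y: "y \<in> cball (q - u) 1 \<inter> U"
      have "dist (p v) y \<le> 1" if v: "v \<in> G" for v
      proof (cases "dist (p v) q < 1")
        case True
        then show ?thesis using y v by (auto simp: U_def)
      next
        case False
        then show ?thesis using active[OF v False] y by simp
      qed
      then show "y \<in> M" using y interior_subset[of K] by (auto simp: M_def U_def)
    qed
    then show ?thesis using \<epsilon> MK' by blast
  qed
  ultimately show ?thesis using K'(1) \<delta>(3) by (intro bexI[of _ K']) auto
qed

section \<open>Closed conditions and nowhere dense sets of bodies\<close>

lemma nowhere_dense_in_subset:
  assumes "nowhere_dense_in X N" "S \<subseteq> N"
  shows "nowhere_dense_in X S"
  using assms interior_of_mono[OF closure_of_mono[OF assms(2), of X], of X]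
  by (auto simp: nowhere_dense_in_def)

lemma comeagre_inI:
  assumes "S \<subseteq> topspace X" "countable \<N>" "\<And>N. N \<in> \<N> \<Longrightarrow> nowhere_dense_in X N"
    and "topspace X - S \<subseteq> \<Union>\<N>"
  shows "comeagre_in X S"
  unfolding comeagre_in_def
proof (intro conjI exI)
  let ?\<M> = "(\<lambda>N. N - S) ` \<N>"
  show "countable ?\<M>" using assms(2) by simp
  show "\<forall>N\<in>?\<M>. nowhere_dense_in X N"
    using assms(3) by (auto intro: nowhere_dense_in_subset)
  have "N \<subseteq> topspace X" if "N \<in> \<N>" for N using assms(3)[OF that] by (simp add: nowhere_dense_in_def)
  then show "topspace X - S = \<Union>?\<M>" using assms(4) by auto
qed (fact assms(1))

lemma nowhere_dense_constant_width_1I: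
  fixes A :: "'a::euclidean_space set set"
  assumes sub: "A \<subseteq> bodies_of_constant_width_1"
    and closed: "\<And>Ks K. (\<And>i. Ks i \<in> A) \<Longrightarrow> K \<in> bodies_of_constant_width_1 \<Longrightarrow>
      (\<lambda>i::nat. hausdorff_dist (Ks i) K) \<longlonglongrightarrow> 0 \<Longrightarrow> K \<in> A"
    and dense: "\<And>K e. K \<in> bodies_of_constant_width_1 \<Longrightarrow> e > 0 \<Longrightarrow>
      \<exists>K'\<in>bodies_of_constant_width_1. hausdorff_dist K' K \<le> e \<and> K' \<notin> A"
  shows "nowhere_dense_in constant_width_1_topology A"
proof -
  interpret H: Metric_space "bodies_of_constant_width_1 :: 'a set set" hausdorff_dist
    by (rule Metric_space_constant_width_1)
  have clo: "closedin H.mtopology A"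
    unfolding H.metric_closedin_iff_sequentially_closed
  proof (intro conjI allI impI sub)
    fix Ks K assume "range Ks \<subseteq> A \<and> limitin H.mtopology Ks K sequentially"
    then show "K \<in> A" using closed[of Ks K] by (auto simp: H.limitin_metric_dist_null)
  qed
  have "H.mtopology interior_of A = {}"
  proof (rule ccontr)
    assume "H.mtopology interior_of A \<noteq> {}"
    then obtain K where K: "K \<in> H.mtopology interior_of A" by blast
    then have KW: "K \<in> bodies_of_constant_width_1"
      using interior_of_subset[of H.mtopology A] sub by blast
    obtain e where e: "e > 0" "H.mball K e \<subseteq> H.mtopology interior_of A"
      using openin_interior_of[of H.mtopology A] K unfolding H.openin_mtopology by blast
    obtain K' where K': "K' \<in> bodies_of_constant_width_1" "hausdorff_dist K' K \<le> e / 2" "K' \<notin> A"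
      using dense[OF KW, of "e / 2"] e by auto
    then have "K' \<in> H.mball K e" using e KW by (simp add: H.commute)
    then show False using e K'(3) interior_of_subset[of H.mtopology A] by blast
  qed
  then show ?thesis using clo sub
    by (simp add: nowhere_dense_in_def constant_width_1_topology_def closure_of_closedin)
qed

lemma infdist_le_hausdorff_dist:
  fixes A B :: "'a::euclidean_space set"
  assumes "A \<in> bodies_of_constant_width_1" "B \<in> bodies_of_constant_width_1"
  shows "a \<in> A \<Longrightarrow> infdist a B \<le> hausdorff_dist A B" "b \<in> B \<Longrightarrow> infdist b A \<le> hausdorff_dist A B"
  using hausdorff_dist_le_iff[of A B "hausdorff_dist A B"] constant_width_1_bodyD[OF assms(1)]
    constant_width_1_bodyD[OF assms(2)] by auto

lemma infdist_null_approximants: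
  fixes p :: "nat \<Rightarrow> 'a::euclidean_space"
  assumes "\<And>i. closed (A i)" "\<And>i. A i \<noteq> {}" and "(\<lambda>i. infdist (p i) (A i)) \<longlonglongrightarrow> 0"
  shows "\<exists>q. (\<forall>i. q i \<in> A i) \<and> (\<lambda>i. p i - q i) \<longlonglongrightarrow> 0"
proof -
  have "\<forall>i. \<exists>q. q \<in> A i \<and> infdist (p i) (A i) = dist (p i) q"
    using infdist_attains_inf assms(1,2) by metis
  then obtain q where q: "\<And>i. q i \<in> A i" "\<And>i. infdist (p i) (A i) = dist (p i) (q i)" by metis
  then have "(\<lambda>i. norm (p i - q i)) \<longlonglongrightarrow> 0" using assms(3) by (simp add: dist_norm)
  then show ?thesis using q(1) tendsto_norm_zero_iff by blast
qed

locale convergent_bodies =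
  fixes Ks :: "nat \<Rightarrow> 'a::euclidean_space set" and K :: "'a set"
  assumes Ks: "\<And>i. Ks i \<in> bodies_of_constant_width_1"
    and K: "K \<in> bodies_of_constant_width_1"
    and conv: "(\<lambda>i. hausdorff_dist (Ks i) K) \<longlonglongrightarrow> 0"
begin

lemma approximants:
  assumes "p \<in> K"
  shows "\<exists>q. (\<forall>i. q i \<in> Ks i) \<and> q \<longlonglongrightarrow> p"
proof -
  have "(\<lambda>i. infdist p (Ks i)) \<longlonglongrightarrow> 0"
    using infdist_le_hausdorff_dist(2)[OF Ks K assms]
    by (intro tendsto_sandwich[OF _ _ tendsto_const conv]) (auto simp: infdist_nonneg)
  then obtain q where q: "\<forall>i. q i \<in> Ks i" "(\<lambda>i. p - q i) \<longlonglongrightarrow> 0"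
    using infdist_null_approximants[of Ks "\<lambda>_. p"] constant_width_1_bodyD[OF Ks] by auto
  from tendsto_diff[OF tendsto_const[of p] q(2)] q(1) show ?thesis by auto
qed

lemma projections:
  assumes "\<And>i. p i \<in> Ks i"
  shows "\<exists>q. (\<forall>i. q i \<in> K) \<and> (\<lambda>i. p i - q i) \<longlonglongrightarrow> 0"
proof -
  have "(\<lambda>i. infdist (p i) K) \<longlonglongrightarrow> 0"
    using infdist_le_hausdorff_dist(1)[OF Ks K assms]
    by (intro tendsto_sandwich[OF _ _ tendsto_const conv]) (auto simp: infdist_nonneg)
  then show ?thesis
    using infdist_null_approximants[of "\<lambda>_. K" p] constant_width_1_bodyD[OF K] by auto
qed

lemma limit_in:
  assumes "\<And>i. p i \<in> Ks i" "p \<longlonglongrightarrow> x"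
  shows "x \<in> K"
proof -
  obtain q where q: "\<forall>i. q i \<in> K" "(\<lambda>i. p i - q i) \<longlonglongrightarrow> 0" using projections assms(1) by blast
  have "q \<longlonglongrightarrow> x" using tendsto_diff[OF assms(2) q(2)] by simp
  then show ?thesis using q(1) constant_width_1_bodyD(4)[OF K] closed_sequentially by blast
qed

lemma subsequence: "strict_mono r \<Longrightarrow> convergent_bodies (Ks \<circ> r) K"
  using Ks K LIMSEQ_subseq_LIMSEQ[OF conv, of r] by unfold_locales (auto simp: o_def)

lemma limit_normal:
  assumes "\<And>i. outer_unit_normal (Ks i) (xs i) (us i)" "xs \<longlonglongrightarrow> x" "us \<longlonglongrightarrow> u"
  shows "outer_unit_normal K x u"
  unfolding outer_unit_normal_def
proof
  have "(\<lambda>i. norm (us i)) \<longlonglongrightarrow> norm u" by (intro tendsto_intros assms)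
  then show "norm u = 1" using assms(1) LIMSEQ_unique[of "\<lambda>i. 1::real"] by (auto simp: outer_unit_normal_def)
  show "\<forall>y\<in>K. y \<bullet> u \<le> x \<bullet> u"
  proof
    fix y assume "y \<in> K"
    then obtain ys where ys: "\<forall>i. ys i \<in> Ks i" "ys \<longlonglongrightarrow> y" using approximants by blast
    show "y \<bullet> u \<le> x \<bullet> u"
      by (rule LIMSEQ_le[OF tendsto_inner[OF ys(2) assms(3)] tendsto_inner[OF assms(2,3)]])
        (use ys assms(1) in \<open>auto simp: outer_unit_normal_def\<close>)
  qed
qed

end

text \<open>The points \<open>x\<close> may be taken from different bodies \<open>Ks i\<close>. They are replaced by nearby points of
the compact limit body \<open>K\<close> in order to extract a convergent subsequence.\<close>

lemma closed_condition_limit: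
  fixes R :: "'a::euclidean_space set \<Rightarrow> 'a \<Rightarrow> 'a \<Rightarrow> 'a \<Rightarrow> bool"
  assumes R: "\<And>Ks K xs us vs x u v. convergent_bodies Ks K \<Longrightarrow>
      xs \<longlonglongrightarrow> x \<Longrightarrow> us \<longlonglongrightarrow> u \<Longrightarrow> vs \<longlonglongrightarrow> v \<Longrightarrow>
      (\<And>i. xs i \<in> Ks i) \<Longrightarrow> (\<And>i. R (Ks i) (xs i) (us i) (vs i)) \<Longrightarrow> R K x u v"
    and conv: "convergent_bodies Ks K"
    and ex: "\<And>i. \<exists>x u v. x \<in> Ks i \<and> norm u = 1 \<and> norm v = 1 \<and> R (Ks i) x u v"
  shows "\<exists>x u v. x \<in> K \<and> norm u = 1 \<and> norm v = 1 \<and> R K x u v"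
proof -
  interpret convergent_bodies Ks K by (rule conv)
  obtain xs us vs where s: "\<And>i. xs i \<in> Ks i" "\<And>i. norm (us i) = 1" "\<And>i. norm (vs i) = 1"
    "\<And>i. R (Ks i) (xs i) (us i) (vs i)"
    using ex by metis
  obtain ys where ys: "\<forall>i. ys i \<in> K" "(\<lambda>i. xs i - ys i) \<longlonglongrightarrow> 0" using projections[of xs] s(1) by blast
  have "compact (K \<times> sphere (0::'a) 1 \<times> sphere (0::'a) 1)"
    by (intro compact_Times compact_sphere constant_width_1_bodyD(1)[OF K])
  moreover have "\<forall>i. (ys i, us i, vs i) \<in> K \<times> sphere (0::'a) 1 \<times> sphere (0::'a) 1" using ys s by auto
  ultimately obtain l r where l: "l \<in> K \<times> sphere (0::'a) 1 \<times> sphere (0::'a) 1"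
    and r: "strict_mono r" "((\<lambda>i. (ys i, us i, vs i)) \<circ> r) \<longlonglongrightarrow> l"
    by (rule seq_compactE[OF compact_imp_seq_compact])
  obtain x u v where l': "l = (x, u, v)" by (cases l)
  have lims: "(ys \<circ> r) \<longlonglongrightarrow> x" "(us \<circ> r) \<longlonglongrightarrow> u" "(vs \<circ> r) \<longlonglongrightarrow> v"
    using tendsto_fst[OF r(2)] tendsto_fst[OF tendsto_snd[OF r(2)]] tendsto_snd[OF tendsto_snd[OF r(2)]]
    by (simp_all add: l' o_def)
  have "(\<lambda>i. (ys \<circ> r) i + (xs (r i) - ys (r i))) \<longlonglongrightarrow> x + 0"
    using LIMSEQ_subseq_LIMSEQ[OF ys(2) r(1)] by (intro tendsto_add lims) (simp add: o_def)
  then have "(xs \<circ> r) \<longlonglongrightarrow> x" by (simp add: o_def)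
  then have "R K x u v"
    by (rule R[OF subsequence[OF r(1)] _ lims(2,3)]) (simp_all add: s)
  then show ?thesis using l l' by auto
qed

definition nonsmooth_bodies :: "real \<Rightarrow> 'a::euclidean_space set set" where
  "nonsmooth_bodies \<rho> = {K \<in> bodies_of_constant_width_1. \<exists>x u v. x \<in> K \<and> norm u = 1 \<and> norm v = 1 \<and>
    (outer_unit_normal K x u \<and> outer_unit_normal K x v \<and> \<rho> \<le> dist u v)}"

lemma nowhere_dense_nonsmooth_bodies:
  assumes "\<rho> > 0"
  shows "nowhere_dense_in constant_width_1_topology (nonsmooth_bodies \<rho> :: 'a::euclidean_space set set)"
proof (rule nowhere_dense_constant_width_1I)
  show "(nonsmooth_bodies \<rho> :: 'a set set) \<subseteq> bodies_of_constant_width_1"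
    by (auto simp: nonsmooth_bodies_def)
next
  fix Ks and K :: "'a set"
  assume Ks: "\<And>i. Ks i \<in> nonsmooth_bodies \<rho>" and K: "K \<in> bodies_of_constant_width_1"
    and "(\<lambda>i::nat. hausdorff_dist (Ks i) K) \<longlonglongrightarrow> 0"
  then have conv: "convergent_bodies Ks K"
    by unfold_locales (auto simp: nonsmooth_bodies_def)
  let ?R = "\<lambda>K x u v. outer_unit_normal K x u \<and> outer_unit_normal K x v \<and> \<rho> \<le> dist u v"
  have "\<exists>x u v. x \<in> K \<and> norm u = 1 \<and> norm v = 1 \<and> ?R K x u v"
  proof (rule closed_condition_limit[OF _ conv, of ?R])
    fix Ks K and xs us vs :: "nat \<Rightarrow> 'a" and x u v
    assume c: "convergent_bodies Ks K" and l: "xs \<longlonglongrightarrow> x" "us \<longlonglongrightarrow> u" "vs \<longlonglongrightarrow> v"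
      and R: "\<And>i. ?R (Ks i) (xs i) (us i) (vs i)"
    have "\<rho> \<le> dist u v"
      by (rule LIMSEQ_le_const[OF tendsto_dist[OF l(2,3)]]) (use R in auto)
    then show "?R K x u v"
      using convergent_bodies.limit_normal[OF c _ l(1,2)] convergent_bodies.limit_normal[OF c _ l(1,3)] R
      by blast
  next
    show "\<exists>x u v. x \<in> Ks i \<and> norm u = 1 \<and> norm v = 1 \<and> ?R (Ks i) x u v" for i
      using Ks[of i] by (simp add: nonsmooth_bodies_def)
  qed
  then show "K \<in> nonsmooth_bodies \<rho>" using K by (simp add: nonsmooth_bodies_def)
next
  fix K :: "'a set" and e :: real assume "K \<in> bodies_of_constant_width_1" "e > 0"
  from constant_width_1_smoothing[OF this] obtain K' r where K': "K' \<in> bodies_of_constant_width_1"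
    "hausdorff_dist K' K \<le> e" "r > 0"
    "\<And>x u. x \<in> K' \<Longrightarrow> outer_unit_normal K' x u \<Longrightarrow> cball (x - r *\<^sub>R u) r \<subseteq> K'" by blast
  have "K' \<notin> nonsmooth_bodies \<rho>"
  proof
    assume "K' \<in> nonsmooth_bodies \<rho>"
    then obtain x u v where "x \<in> K'" "norm u = 1" "outer_unit_normal K' x u" "outer_unit_normal K' x v" "\<rho> \<le> dist u v"
      by (auto simp: nonsmooth_bodies_def)
    then show False using inner_ball_unique_normal[of u r x K' v] K' assms by auto
  qed
  then show "\<exists>K'\<in>bodies_of_constant_width_1. hausdorff_dist K' K \<le> e \<and> K' \<notin> nonsmooth_bodies \<rho>"
    using K' by blast
qed

text \<open>The last clause says that the part of \<open>K\<close> near \<open>x\<close> and on the side of \<open>t\<close>, projected to the plane of \<open>u\<close>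
and \<open>t\<close>, lies under the parabola
with radius of curvature \<open>1 - \<rho>\<close> at its vertex. A parabola instead of a circle changes the
curvature only in higher order; a strict bound on \<open>dist p x\<close> makes the condition pass to limits.\<close>

definition subunit_radius_at :: "real \<Rightarrow> 'a::euclidean_space set \<Rightarrow> 'a \<Rightarrow> 'a \<Rightarrow> 'a \<Rightarrow> bool" where
  "subunit_radius_at \<rho> K x u t \<longleftrightarrow> outer_unit_normal K x u \<and> orthogonal u t \<and>
    cball (x - \<rho> *\<^sub>R u) \<rho> \<subseteq> K \<and>
    (\<forall>p\<in>K. dist p x < \<rho> \<longrightarrow> 0 < (p - x) \<bullet> t \<longrightarrow> ((p - x) \<bullet> t)\<^sup>2 \<le> 2 * (1 - \<rho>) * ((x - p) \<bullet> u))"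

definition subunit_radius_bodies :: "'a::euclidean_space \<Rightarrow> real \<Rightarrow> 'a set set" where
  "subunit_radius_bodies d \<rho> = {K \<in> bodies_of_constant_width_1. \<exists>x u t. x \<in> K \<and> norm u = 1 \<and> norm t = 1 \<and>
    (subunit_radius_at \<rho> K x u t \<and> dist u d \<le> 1/8)}"

lemma subunit_radius_atD:
  assumes "subunit_radius_at \<rho> K x u t"
  shows "outer_unit_normal K x u" "orthogonal u t" "cball (x - \<rho> *\<^sub>R u) \<rho> \<subseteq> K"
    and "\<And>p. p \<in> K \<Longrightarrow> dist p x < \<rho> \<Longrightarrow> 0 < (p - x) \<bullet> t \<Longrightarrow>
      ((p - x) \<bullet> t)\<^sup>2 \<le> 2 * (1 - \<rho>) * ((x - p) \<bullet> u)"
  using assms by (simp_all add: subunit_radius_at_def)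

lemma not_subunit_radius_if_locally_spherical:
  fixes K :: "'a::euclidean_space set"
  assumes sph: "cball (x - u) 1 \<inter> ball x \<epsilon> \<subseteq> K" "\<epsilon> > 0" and t: "norm t = 1" and \<rho>: "\<rho> > 0"
  shows "\<not> subunit_radius_at \<rho> K x u t"
proof
  assume flat: "subunit_radius_at \<rho> K x u t"
  have u: "norm u = 1" "u \<bullet> u = 1" "t \<bullet> t = 1" "u \<bullet> t = 0" "t \<bullet> u = 0"
    using subunit_radius_atD(1,2)[OF flat] t
    by (simp_all add: outer_unit_normal_def orthogonal_def norm_eq_1 inner_commute[of t u])
  define \<mu> where "\<mu> = min \<epsilon> (min \<rho> 1)"
  have \<mu>: "0 < \<mu>" "\<mu> \<le> \<epsilon>" "\<mu> \<le> \<rho>" "\<mu> \<le> 1" using sph \<rho> by (auto simp: \<mu>_def)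
  \<comment> \<open>The point \<open>x + m t - l u\<close> with \<open>m\<^sup>2 = 2 l - l\<^sup>2\<close> lies on the unit sphere around \<open>x - u\<close>, at distance
    \<open>sqrt (2 l)\<close> from \<open>x\<close>. For \<open>l < 2 \<rho>\<close> it is outside the parabola with radius \<open>1 - \<rho>\<close>.\<close>
  define l where "l = \<mu>\<^sup>2 / 4"
  have "\<mu> * \<mu> \<le> \<rho> * 1" "\<mu> * \<mu> \<le> 1 * 1"
    using \<mu> by (intro mult_mono; linarith)+
  then have l: "0 < l" "l < 2 * \<rho>" "l \<le> 1" using \<mu> \<rho> by (auto simp: l_def power2_eq_square)
  define m where "m = sqrt (2 * l - l\<^sup>2)"
  have "l * l \<le> l * 1" using l by (intro mult_left_mono) auto
  have "l * l < 2 * l" using l \<open>l * l \<le> l * 1\<close> by simp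
  then have m: "m > 0" "m\<^sup>2 = 2 * l - l\<^sup>2" by (auto simp: m_def power2_eq_square)
  define p where "p = x + m *\<^sub>R t - l *\<^sub>R u"
  have pu: "(p - x) \<bullet> u = - l" "(p - x) \<bullet> t = m" using u by (simp_all add: p_def inner_diff_left inner_add_left)
  have "(norm (p - x))\<^sup>2 = m\<^sup>2 + l\<^sup>2"
    unfolding power2_norm_eq_inner using u
    by (simp add: p_def inner_diff_left inner_diff_right power2_eq_square)
  then have np: "(norm (p - x))\<^sup>2 = 2 * l" using m by simp
  then have "(norm (p - x))\<^sup>2 < \<mu>\<^sup>2" using np zero_less_power[OF \<mu>(1), of 2] unfolding l_def by linarith
  then have "dist p x < \<mu>" using \<mu> by (simp add: dist_norm power2_less_imp_less)
  moreover have "p \<in> cball (x - u) 1" using np pu u by (simp only: in_unit_ball_iff)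
  ultimately have "p \<in> K" "dist p x < \<rho>" using sph \<mu> by (auto simp: dist_commute)
  then have "m\<^sup>2 \<le> 2 * (1 - \<rho>) * ((x - p) \<bullet> u)"
    using subunit_radius_atD(4)[OF flat, of p] pu m(1) by simp
  also have "(x - p) \<bullet> u = l" using pu(1) by (simp add: inner_diff_left)
  finally have "l * (2 * \<rho>) \<le> l * l" using m by (simp add: algebra_simps power2_eq_square)
  then show False using l by simp
qed

lemma subunit_radius_at_limit:
  assumes c: "convergent_bodies Ks K" and x: "xs \<longlonglongrightarrow> x" and u: "us \<longlonglongrightarrow> u" and t: "ts \<longlonglongrightarrow> t"
    and R: "\<And>i. subunit_radius_at \<rho> (Ks i) (xs i) (us i) (ts i)"
  shows "subunit_radius_at \<rho> K x u t"
  unfolding subunit_radius_at_def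
proof (intro conjI ballI impI subsetI)
  interpret convergent_bodies Ks K by (rule c)
  show "outer_unit_normal K x u"
    by (rule limit_normal[OF subunit_radius_atD(1)[OF R] x u])
  have "(\<lambda>i. us i \<bullet> ts i) \<longlonglongrightarrow> u \<bullet> t" by (intro tendsto_intros u t)
  then show "orthogonal u t"
    using subunit_radius_atD(2)[OF R] by (simp add: orthogonal_def LIMSEQ_const_iff)
  fix q assume q: "q \<in> cball (x - \<rho> *\<^sub>R u) \<rho>"
  have "(\<lambda>i. q + (xs i - \<rho> *\<^sub>R us i) - (x - \<rho> *\<^sub>R u)) \<longlonglongrightarrow> q + (x - \<rho> *\<^sub>R u) - (x - \<rho> *\<^sub>R u)"
    by (intro tendsto_intros x u)
  moreover have "q + (xs i - \<rho> *\<^sub>R us i) - (x - \<rho> *\<^sub>R u) \<in> Ks i" for i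
  proof (rule subsetD[OF subunit_radius_atD(3)[OF R[of i]]])
    have "xs i - \<rho> *\<^sub>R us i - (q + (xs i - \<rho> *\<^sub>R us i) - (x - \<rho> *\<^sub>R u)) = x - \<rho> *\<^sub>R u - q" by simp
    with q show "q + (xs i - \<rho> *\<^sub>R us i) - (x - \<rho> *\<^sub>R u) \<in> cball (xs i - \<rho> *\<^sub>R us i) \<rho>"
      by (simp only: mem_cball dist_norm)
  qed
  ultimately show "q \<in> K"
    by (intro limit_in[of "\<lambda>i. q + (xs i - \<rho> *\<^sub>R us i) - (x - \<rho> *\<^sub>R u)" q]) simp_all
next
  interpret convergent_bodies Ks K by (rule c)
  fix p assume p: "p \<in> K" "dist p x < \<rho>" "0 < (p - x) \<bullet> t"
  then obtain ps where ps: "\<forall>i. ps i \<in> Ks i" "ps \<longlonglongrightarrow> p" using approximants by blast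
  have d: "(\<lambda>i. dist (ps i) (xs i)) \<longlonglongrightarrow> dist p x" by (intro tendsto_intros ps x)
  have i: "(\<lambda>i. (ps i - xs i) \<bullet> ts i) \<longlonglongrightarrow> (p - x) \<bullet> t" by (intro tendsto_intros ps x t)
  have lhs: "(\<lambda>i. ((ps i - xs i) \<bullet> ts i)\<^sup>2) \<longlonglongrightarrow> ((p - x) \<bullet> t)\<^sup>2" by (intro tendsto_intros ps x t)
  have rhs: "(\<lambda>i. 2 * (1 - \<rho>) * ((xs i - ps i) \<bullet> us i)) \<longlonglongrightarrow> 2 * (1 - \<rho>) * ((x - p) \<bullet> u)"
    by (intro tendsto_intros ps x u)
  have "\<forall>\<^sub>F i in sequentially. ((ps i - xs i) \<bullet> ts i)\<^sup>2 \<le> 2 * (1 - \<rho>) * ((xs i - ps i) \<bullet> us i)"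
    using order_tendstoD(2)[OF d p(2)] order_tendstoD(1)[OF i p(3)]
    by eventually_elim (rule subunit_radius_atD(4)[OF R], use ps in auto)
  then show "((p - x) \<bullet> t)\<^sup>2 \<le> 2 * (1 - \<rho>) * ((x - p) \<bullet> u)"
    by (rule tendsto_le[OF sequentially_bot rhs lhs])
qed

lemma nowhere_dense_subunit_radius_bodies:
  fixes d :: "'a::euclidean_space"
  assumes \<rho>: "\<rho> > 0"
  shows "nowhere_dense_in constant_width_1_topology (subunit_radius_bodies d \<rho>)"
proof (rule nowhere_dense_constant_width_1I)
  show "subunit_radius_bodies d \<rho> \<subseteq> bodies_of_constant_width_1"
    by (auto simp: subunit_radius_bodies_def)
next
  fix Ks and K :: "'a set"
  assume Ks: "\<And>i. Ks i \<in> subunit_radius_bodies d \<rho>" and K: "K \<in> bodies_of_constant_width_1"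
    and "(\<lambda>i::nat. hausdorff_dist (Ks i) K) \<longlonglongrightarrow> 0"
  then have conv: "convergent_bodies Ks K"
    by unfold_locales (auto simp: subunit_radius_bodies_def)
  let ?R = "\<lambda>K x u t. subunit_radius_at \<rho> K x u t \<and> dist u d \<le> 1/8"
  have "\<exists>x u v. x \<in> K \<and> norm u = 1 \<and> norm v = 1 \<and> ?R K x u v"
  proof (rule closed_condition_limit[OF _ conv, of ?R])
    fix Ks K and xs us vs :: "nat \<Rightarrow> 'a" and x u v
    assume c: "convergent_bodies Ks K" and l: "xs \<longlonglongrightarrow> x" "us \<longlonglongrightarrow> u" "vs \<longlonglongrightarrow> v"
      and R: "\<And>i. ?R (Ks i) (xs i) (us i) (vs i)"
    have "dist u d \<le> 1/8"
      by (rule LIMSEQ_le_const2[OF tendsto_dist[OF l(2) tendsto_const]]) (use R in auto)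
    then show "?R K x u v"
      using subunit_radius_at_limit[OF c l] R by blast
  next
    show "\<exists>x u v. x \<in> Ks i \<and> norm u = 1 \<and> norm v = 1 \<and> ?R (Ks i) x u v" for i
      using Ks[of i] by (simp add: subunit_radius_bodies_def)
  qed
  then show "K \<in> subunit_radius_bodies d \<rho>" using K by (simp add: subunit_radius_bodies_def)
next
  fix K :: "'a set" and e :: real assume K: "K \<in> bodies_of_constant_width_1" and e: "e > 0"
  have e2: "e / 2 > 0" using e by simp
  obtain K1 r where K1: "K1 \<in> bodies_of_constant_width_1"
    "hausdorff_dist K1 K \<le> e / 2" "r > 0"
    "\<And>x u. x \<in> K1 \<Longrightarrow> outer_unit_normal K1 x u \<Longrightarrow> cball (x - r *\<^sub>R u) r \<subseteq> K1"
    using constant_width_1_smoothing[OF K e2] by blast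
  obtain K2 where K2: "K2 \<in> bodies_of_constant_width_1" "hausdorff_dist K2 K1 \<le> e / 2"
    "\<And>x u s. x \<in> K2 \<Longrightarrow> outer_unit_normal K2 x u \<Longrightarrow> dist u d \<le> 1/8 \<Longrightarrow>
        s > 0 \<Longrightarrow> cball (x - s *\<^sub>R u) s \<subseteq> K2 \<Longrightarrow> \<exists>\<epsilon>>0. cball (x - u) 1 \<inter> ball x \<epsilon> \<subseteq> K2"
    using locally_spherical_approximation[OF K1(1) e2 K1(3,4), of d] by blast
  have "hausdorff_dist K2 K \<le> hausdorff_dist K2 K1 + hausdorff_dist K1 K"
    by (rule Metric_space.triangle[OF Metric_space_constant_width_1 K2(1) K1(1) K])
  then have "hausdorff_dist K2 K \<le> e" using K1 K2 by simp
  moreover have "K2 \<notin> subunit_radius_bodies d \<rho>"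
  proof
    assume "K2 \<in> subunit_radius_bodies d \<rho>"
    then obtain x u t where *: "x \<in> K2" "norm t = 1" "subunit_radius_at \<rho> K2 x u t" "dist u d \<le> 1/8"
      by (auto simp: subunit_radius_bodies_def)
    obtain \<epsilon> where "\<epsilon> > 0" "cball (x - u) 1 \<inter> ball x \<epsilon> \<subseteq> K2"
      using K2(3)[OF *(1) subunit_radius_atD(1)[OF *(3)] *(4) \<rho> subunit_radius_atD(3)[OF *(3)]] by blast
    then show False using not_subunit_radius_if_locally_spherical[of x u \<epsilon> K2 t \<rho>] * \<rho> by blast
  qed
  ultimately show "\<exists>K'\<in>bodies_of_constant_width_1. hausdorff_dist K' K \<le> e \<and> K' \<notin> subunit_radius_bodies d \<rho>"
    using K2 by blast
qed

section \<open>Planar radii of curvature\<close>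

lemma convex_between:
  fixes p u :: "'a::real_vector"
  assumes K: "convex K" "p + a *\<^sub>R u \<in> K" "p + b *\<^sub>R u \<in> K" and c: "a \<le> c" "c \<le> b"
  shows "p + c *\<^sub>R u \<in> K"
proof (cases "a = b")
  case False
  define s where "s = (c - a) / (b - a)"
  have s: "0 \<le> s" "s \<le> 1" "s * (b - a) = c - a" using c False by (auto simp: s_def divide_le_eq_1)
  have "(1 - s) *\<^sub>R (p + a *\<^sub>R u) + s *\<^sub>R (p + b *\<^sub>R u) \<in> K"
    using K s by (intro convexD) auto
  also have "(1 - s) *\<^sub>R (p + a *\<^sub>R u) + s *\<^sub>R (p + b *\<^sub>R u) = p + (a + s * (b - a)) *\<^sub>R u"
    by (simp add: algebra_simps)
  finally show ?thesis using s(3) by simp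
qed (use assms in auto)

lemma in_plane_through_iff:
  "y \<in> plane_through x u t \<longleftrightarrow> (\<exists>l m. y = x + l *\<^sub>R u + m *\<^sub>R t)"
  by (auto simp: plane_through_def span_insert span_singleton image_iff algebra_simps; metis add.commute add_diff_cancel_left')

text \<open>A segment of direction \<open>u\<close> in \<open>M\<close> ensures that \<open>u\<close> is parallel to the affine hull of \<open>M\<close>, so the last
point of \<open>M\<close> on a ray of direction \<open>u\<close> is a relative boundary point.\<close>

lemma top_boundary_point:
  fixes M :: "'a::euclidean_space set"
  assumes M: "compact M" and a: "a \<in> M" "a - u \<in> M" and u: "norm u = 1" and z: "z \<in> M"
  shows "\<exists>s\<ge>0. z + s *\<^sub>R u \<in> M \<and> z + s *\<^sub>R u \<in> rel_frontier M"
proof -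
  let ?T = "(\<lambda>s. z + s *\<^sub>R u) -` M"
  have "closed ?T"
    using M by (intro continuous_closed_vimage compact_imp_closed) (auto intro!: continuous_intros)
  moreover have "bounded ?T"
  proof -
    obtain R where R: "\<And>y. y \<in> M \<Longrightarrow> norm y \<le> R" using M compact_imp_bounded bounded_pos by metis
    have "norm s \<le> R + norm z" if "s \<in> ?T" for s
      using R[of "z + s *\<^sub>R u"] that norm_triangle_ineq4[of "z + s *\<^sub>R u" z] u by simp
    then show ?thesis by (rule boundedI)
  qed
  ultimately have "compact ?T" by (simp add: compact_eq_bounded_closed)
  moreover have "0 \<in> ?T" using z by simp
  ultimately obtain s where s: "s \<in> ?T" "\<And>s'. s' \<in> ?T \<Longrightarrow> s' \<le> s"
    using compact_attains_sup[of ?T] by blast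
  let ?y = "z + s *\<^sub>R u"
  have "?y \<notin> rel_interior M"
  proof
    assume "?y \<in> rel_interior M"
    then obtain e where e: "e > 0" "cball ?y e \<inter> affine hull M \<subseteq> M"
      by (auto simp: mem_rel_interior_cball)
    have "?y + e *\<^sub>R (a - (a - u)) \<in> affine hull M"
      using s(1) a by (intro mem_affine_3_minus) (auto simp: hull_inc)
    then have "?y + e *\<^sub>R u \<in> M" using e u by (intro subsetD[OF e(2)]) (auto simp: dist_norm)
    then have "s + e \<in> ?T" by (simp add: algebra_simps)
    then show False using s(2)[of "s + e"] e by simp
  qed
  then show ?thesis using s(1) s(2)[OF \<open>0 \<in> ?T\<close>] closure_subset[of M]
    by (intro exI[of _ s]) (auto simp: rel_frontier_def)
qed

lemma norm_sq_plane:
  fixes u t :: "'a::euclidean_space"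
  assumes "norm u = 1" "norm t = 1" "orthogonal u t"
  shows "(norm (l *\<^sub>R u + m *\<^sub>R t))\<^sup>2 = l\<^sup>2 + m\<^sup>2"
  using assms unfolding power2_norm_eq_inner
  by (simp add: inner_add_left inner_add_right orthogonal_def norm_eq_1 inner_commute power2_eq_square)

lemma plane_coordinates:
  fixes u t :: "'a::euclidean_space"
  assumes "norm u = 1" "norm t = 1" "orthogonal u t"
  shows "(x + l *\<^sub>R u + m *\<^sub>R t - x) \<bullet> u = l" "(x + l *\<^sub>R u + m *\<^sub>R t - x) \<bullet> t = m"
proof -
  have "u \<bullet> u = 1" "t \<bullet> t = 1" "u \<bullet> t = 0" "t \<bullet> u = 0"
    using assms by (auto simp: orthogonal_def norm_eq_1 inner_commute)
  then show "(x + l *\<^sub>R u + m *\<^sub>R t - x) \<bullet> u = l" "(x + l *\<^sub>R u + m *\<^sub>R t - x) \<bullet> t = m"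
    by (simp_all add: inner_add_left inner_diff_left)
qed

lemma plane_Bessel:
  fixes u t :: "'a::euclidean_space"
  assumes "norm u = 1" "norm t = 1" "orthogonal u t"
  shows "(v \<bullet> u)\<^sup>2 + (v \<bullet> t)\<^sup>2 \<le> (norm v)\<^sup>2"
proof -
  have uu: "u \<bullet> u = 1" "t \<bullet> t = 1" "u \<bullet> t = 0" "t \<bullet> u = 0"
    using assms by (auto simp: orthogonal_def norm_eq_1 inner_commute)
  have "0 \<le> (norm (v - (v \<bullet> u) *\<^sub>R u - (v \<bullet> t) *\<^sub>R t))\<^sup>2" by simp
  also have "\<dots> = (norm v)\<^sup>2 - (v \<bullet> u)\<^sup>2 - (v \<bullet> t)\<^sup>2"
    unfolding power2_norm_eq_inner using uu
    by (simp add: inner_diff_left inner_diff_right inner_commute power2_eq_square algebra_simps)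
  finally show ?thesis by simp
qed

text \<open>A ray from \<open>x\<close> that misses \<open>K\<close> can be separated from \<open>K\<close>; the separating hyperplane
passes through \<open>x\<close> and yields a normal at \<open>x\<close> that does not form an obtuse angle with the ray, so it is not \<open>u\<close>.\<close>

lemma smooth_point_cone:
  fixes K :: "'a::euclidean_space set"
  assumes K: "convex K" "x \<in> K" and n: "\<And>v. outer_unit_normal K x v \<Longrightarrow> v = u" and v: "v \<bullet> u < 0"
  shows "\<exists>s>0. x + s *\<^sub>R v \<in> K"
proof (rule ccontr)
  assume no: "\<not> ?thesis"
  let ?R = "(\<lambda>s. x + s *\<^sub>R v) ` {0<..}"
  have "convex ?R"
  proof -
    have "?R = (+) x ` ((\<lambda>s. s *\<^sub>R v) ` {0<..})" by (auto simp: image_image)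
    moreover have "convex ((\<lambda>s. s *\<^sub>R v) ` {0::real<..})"
      by (intro convex_linear_image) (auto intro: linearI simp: scaleR_add_left)
    ultimately show ?thesis by (metis convex_translation)
  qed
  moreover have "K \<inter> ?R = {}" using no by auto
  ultimately obtain a b where ab: "a \<noteq> 0" "\<forall>y\<in>K. a \<bullet> y \<le> b" "\<forall>y\<in>?R. b \<le> a \<bullet> y"
    using separating_hyperplane_sets[of K ?R] K by auto
  have ray: "b \<le> a \<bullet> x + s * (a \<bullet> v)" if "s > 0" for s
    using ab(3) that by (force simp: inner_add_right)
  have "b \<le> a \<bullet> x + e" if "e > 0" for e
  proof -
    define s where "s = e / (\<bar>a \<bullet> v\<bar> + 1)"
    have s: "s > 0" "s * (\<bar>a \<bullet> v\<bar> + 1) = e" using that by (auto simp: s_def add_nonneg_pos)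
    have "s * (a \<bullet> v) \<le> s * (\<bar>a \<bullet> v\<bar> + 1)" using s by (intro mult_left_mono) auto
    then show ?thesis using ray[OF s(1)] s(2) by simp
  qed
  then have "b \<le> a \<bullet> x" by (rule field_le_epsilon)
  then have "\<forall>y\<in>K. a \<bullet> y \<le> a \<bullet> x" using ab(2) by force
  then have "outer_unit_normal K x (sgn a)"
    using ab(1) by (auto simp: outer_unit_normal_def norm_sgn sgn_div_norm inner_commute divide_right_mono mult_left_mono)
  then have "sgn a = u" by (rule n)
  then have "a \<bullet> v < 0" using v ab(1)
    by (auto simp: sgn_div_norm inner_commute mult_less_0_iff dest: sym)
  then show False using ray[of 1] ab(2) \<open>b \<le> a \<bullet> x\<close> K(2) by force
qed

text \<open>The region beyond the parabola \<open>l = n * m\<^sup>2\<close>, where \<open>l\<close> is measured downwards from the tangent line, cut off at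
depth \<open>1 / n\<close>. Aperture and size are coupled to the one parameter \<open>n\<close>, so that finitely many
directions can be handled by one large \<open>n\<close>.\<close>

definition parabola_inside :: "'a::euclidean_space set \<Rightarrow> 'a \<Rightarrow> 'a \<Rightarrow> nat \<Rightarrow> 'a \<Rightarrow> bool" where
  "parabola_inside K x u n t \<longleftrightarrow> (\<forall>m l. 0 \<le> m \<longrightarrow> m \<le> 1 / real n \<longrightarrow> real n * m\<^sup>2 \<le> l \<longrightarrow> l \<le> 1 / real n \<longrightarrow>
     x + m *\<^sub>R t - l *\<^sub>R u \<in> K)"

text \<open>If the lower radius exceeds \<open>r\<close>, boundary points of the section close to \<open>x\<close> lie outside the circle of radius \<open>r\<close> that
touches at \<open>x\<close>, hence either at depth at most \<open>m\<^sup>2 / r\<close> or on the far side of the circle. Smoothness at \<open>x\<close> puts the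
points \<open>x + m (t - u)\<close> with small \<open>m\<close> into \<open>K\<close>, and the boundary points above them are too near to \<open>x\<close>
to be on the far side.\<close>

lemma parabola_inside_if_positive_lower_radius:
  fixes K :: "'a::euclidean_space set"
  assumes K: "K \<in> bodies_of_constant_width_1" and x: "x \<in> K" "outer_unit_normal K x u"
    and unique: "\<And>v. outer_unit_normal K x v \<Longrightarrow> v = u"
    and t: "norm t = 1" "orthogonal u t"
    and pos: "planar_lower_radius (K \<inter> plane_through x u t) x u t \<noteq> 0"
  shows "\<forall>\<^sub>F n in sequentially. parabola_inside K x u n t"
proof -
  note c = constant_width_1_bodyD[OF K]
  have u: "norm u = 1" using x(2) by (simp add: outer_unit_normal_def)
  define M where "M = K \<inter> plane_through x u t"
  have "0 < planar_lower_radius M x u t" using pos by (simp add: M_def zero_less_iff_neq_zero)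
  then obtain y where y: "0 < y" "y < planar_lower_radius M x u t" using dense by blast
  then obtain r where r: "y = ennreal r" "r > 0"
    by (cases y) (auto simp: ennreal_less_zero_iff)
  have "\<forall>\<^sub>F z in at x within (open_half_plane x u t \<inter> rel_frontier M). y < circle_radius x u t z"
    using less_LiminfD y(2) unfolding planar_lower_radius_def by blast
  then obtain d where d: "d > 0" "\<And>z. z \<in> open_half_plane x u t \<Longrightarrow> z \<in> rel_frontier M \<Longrightarrow> z \<noteq> x \<Longrightarrow>
      dist z x < d \<Longrightarrow> y < circle_radius x u t z"
    by (auto simp: eventually_at)
  have "u \<bullet> u = 1" "t \<bullet> u = 0"
    using t u by (auto simp: orthogonal_def norm_eq_1 inner_commute)
  then have "(t - u) \<bullet> u < 0" by (simp add: inner_diff_left)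
  then obtain s1 where s1: "s1 > 0" "x + s1 *\<^sub>R (t - u) \<in> K"
    using smooth_point_cone[OF c(2) x(1) unique] by blast
  have xu: "x - u \<in> K" by (rule constant_width_1_antipode[OF K x])
  have "closed (plane_through x u t)"
    unfolding plane_through_def by (intro closed_translation closed_subspace subspace_span)
  then have M: "compact M" "convex M" "x \<in> M" "x - u \<in> M"
  proof -
    show "compact M" unfolding M_def using c(1) \<open>closed (plane_through x u t)\<close> by (rule compact_Int_closed)
    show "convex M" unfolding M_def plane_through_def
      by (intro convex_Int c convex_translation subspace_imp_convex subspace_span)
    have "x = x + 0 *\<^sub>R u + 0 *\<^sub>R t" "x - u = x + (-1) *\<^sub>R u + 0 *\<^sub>R t" by simp_all
    then show "x \<in> M" "x - u \<in> M" using x(1) xu unfolding M_def Int_iff in_plane_through_iff by blast+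
  qed
  define m0 where "m0 = min (min s1 1) (min (d / 4) (r / 2))"
  have m0: "0 < m0" "m0 \<le> s1" "m0 \<le> 1" "m0 \<le> d / 4" "m0 \<le> r / 2"
    using s1 d r by (auto simp: m0_def)
  have diag: "x + m *\<^sub>R (t - u) \<in> K" if "0 \<le> m" "m \<le> m0" for m
    using convex_between[of K x 0 "t - u" s1 m] c(2) x(1) s1 m0 that by simp
  have bottom: "x + m *\<^sub>R t - m0 *\<^sub>R u \<in> K" if "0 \<le> m" "m \<le> m0" for m
  proof -
    have "x + (- m0) *\<^sub>R u \<in> K"
      using convex_between[of K x "-1" u 0 "- m0"] c(2) x(1) xu m0 by simp
    moreover have corner: "x + (- m0) *\<^sub>R u + m0 *\<^sub>R t = x + m0 *\<^sub>R (t - u)"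
      by (simp add: algebra_simps)
    have "x + (- m0) *\<^sub>R u + m0 *\<^sub>R t \<in> K" unfolding corner using diag[of m0] m0 by simp
    ultimately have "x + (- m0) *\<^sub>R u + m *\<^sub>R t \<in> K"
      by (intro convex_between[OF c(2), of _ 0 t m0 m]) (use that in simp_all)
    then show ?thesis by (simp add: algebra_simps)
  qed
  have region: "x + m *\<^sub>R t - l *\<^sub>R u \<in> K" if m: "0 \<le> m" "m \<le> m0" and l: "m\<^sup>2 / r \<le> l" "l \<le> m0" for m l
  proof (cases "m = 0")
    case True
    then show ?thesis using convex_between[of K x "-1" u 0 "- l"] c(2) x(1) xu m0 l by simp
  next
    case False
    then have mpos: "m > 0" using m by simp
    let ?z = "x + m *\<^sub>R (t - u)"
    have z: "?z = x + (- m) *\<^sub>R u + m *\<^sub>R t" by (simp add: algebra_simps)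
    then have "?z \<in> M" using diag[OF m] unfolding M_def Int_iff in_plane_through_iff by blast
    then obtain s where s: "s \<ge> 0" "?z + s *\<^sub>R u \<in> M" "?z + s *\<^sub>R u \<in> rel_frontier M"
      using top_boundary_point[OF M(1,3,4) u] by blast
    define k where "k = m - s"
    have zs: "?z + s *\<^sub>R u = x + (- k) *\<^sub>R u + m *\<^sub>R t" by (simp add: k_def algebra_simps)
    have nz: "(norm (?z + s *\<^sub>R u - x))\<^sup>2 = k\<^sup>2 + m\<^sup>2"
      unfolding zs using norm_sq_plane[OF u t, of "- k" m] by (simp add: add.assoc)
    have "?z + s *\<^sub>R u \<in> K" using s(2) by (simp add: M_def)
    from constant_width_1_in_unit_ball[OF K x this]
    have "k\<^sup>2 + m\<^sup>2 \<le> 2 * k" unfolding nz unfolding zs plane_coordinates[OF u t] by simp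
    moreover have "0 < m\<^sup>2" using mpos by simp
    ultimately have kpos: "0 < k" using zero_le_power2[of k] by linarith
    have km: "k \<le> m" using s(1) by (simp add: k_def)
    have "(norm (?z + s *\<^sub>R u - x))\<^sup>2 < d\<^sup>2"
    proof -
      have "k\<^sup>2 + m\<^sup>2 \<le> m\<^sup>2 + m\<^sup>2" using km kpos by (intro add_right_mono power_mono) auto
      also have "\<dots> < (2 * m)\<^sup>2" using mpos by (simp add: power2_eq_square)
      also have "\<dots> \<le> d\<^sup>2" using m m0 mpos by (intro power_mono) auto
      finally show ?thesis unfolding nz .
    qed
    then have "dist (?z + s *\<^sub>R u) x < d" using d(1) by (simp add: dist_norm power2_less_imp_less)
    moreover have "?z + s *\<^sub>R u \<in> open_half_plane x u t" unfolding zs open_half_plane_def using mpos by blast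
    moreover have "?z + s *\<^sub>R u \<noteq> x" using nz kpos mpos by (auto simp: power2_eq_square add_nonneg_eq_0_iff)
    ultimately have "y < circle_radius x u t (?z + s *\<^sub>R u)" using d(2) s(3) by blast
    then have "ennreal r < ennreal ((k\<^sup>2 + m\<^sup>2) / (2 * k))"
      unfolding zs using circle_radius_eq[OF u t, of "- k" m x] kpos mpos by (simp add: r)
    then have "r < (k\<^sup>2 + m\<^sup>2) / (2 * k)" using r by (simp add: ennreal_less_iff)
    then have "2 * k * r < k * k + m\<^sup>2" using kpos by (simp add: field_simps power2_eq_square)
    moreover have "k * k \<le> k * r" using km m m0 r kpos by (intro mult_left_mono) auto
    ultimately have "k * r \<le> m\<^sup>2" by simp
    then have "k \<le> m\<^sup>2 / r" using r by (simp add: field_simps)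
    then have "k \<le> l" using l by simp
    have "x + m *\<^sub>R t + (- m0) *\<^sub>R u \<in> K" using bottom[OF m] by simp
    moreover have "x + m *\<^sub>R t + (- k) *\<^sub>R u \<in> K"
      using \<open>?z + s *\<^sub>R u \<in> K\<close> unfolding zs by (simp add: algebra_simps)
    ultimately show ?thesis
      using convex_between[of K "x + m *\<^sub>R t" "- m0" u "- k" "- l"] c(2) \<open>k \<le> l\<close> l by simp
  qed
  have "\<forall>\<^sub>F n in sequentially. C \<le> real n" for C
    using filterlim_real_sequentially unfolding filterlim_at_top by blast
  from this[of "1 / m0"] this[of "1 / r"] eventually_gt_at_top[of "0::nat"]
  show ?thesis
  proof eventually_elim
    case (elim n)
    have n: "1 / real n \<le> m0" using elim m0 by (simp add: field_simps)
    have "m\<^sup>2 / r \<le> real n * m\<^sup>2" for m :: real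
      using mult_right_mono[OF elim(2), of "m\<^sup>2"] by simp
    then show ?case unfolding parabola_inside_def
      using n by (intro allI impI region) (auto intro: order_trans)
  qed
qed

text \<open>A tangent vector \<open>w = (\<Sum>b\<in>B. (w \<bullet> b) b)\<close> is the average of the vectors \<open>N (w \<bullet> b) b\<close>, where \<open>N\<close> is the number
of elements of \<open>B\<close>. By convexity, the parabolas in the directions \<open>\<plusminus>b\<close> thus give a paraboloid inside \<open>K\<close>, and this
contains a small touching ball.\<close>

lemma inner_ball_if_parabolas_inside:
  fixes K :: "'a::euclidean_space set"
  assumes K: "convex K" and u: "norm u = 1" and dim: "DIM('a) \<ge> 2"
    and par: "\<And>t. norm t = 1 \<Longrightarrow> orthogonal u t \<Longrightarrow> \<forall>\<^sub>F n in sequentially. parabola_inside K x u n t"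
  shows "\<exists>\<rho>>0. cball (x - \<rho> *\<^sub>R u) \<rho> \<subseteq> K"
proof -
  obtain S where S: "u \<in> S" "pairwise orthogonal S" "\<And>b. b \<in> S \<Longrightarrow> norm b = 1"
    "independent S" "card S = DIM('a)" "span S = (UNIV :: 'a set)"
    using vector_in_orthonormal_basis[OF u] by metis
  define B where "B = S - {u}"
  have finS: "finite S" using S(4) by (rule finiteI_independent)
  then have finB: "finite B" by (simp add: B_def)
  define N where "N = real (card B)"
  have N1: "N \<ge> 1" using dim S(1,5) finS by (simp add: N_def B_def)
  have B: "norm b = 1" "orthogonal u b" "orthogonal b u" if "b \<in> B" for b
    using that S(1-3) by (auto simp: B_def pairwise_def)
  have "\<forall>\<^sub>F n in sequentially. (\<forall>b\<in>B. parabola_inside K x u n b \<and> parabola_inside K x u n (- b)) \<and> 0 < n"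
    using B by (intro eventually_conj eventually_gt_at_top eventually_ball_finite finB ballI par)
      (auto simp: orthogonal_def)
  then obtain n where n: "n > 0" "\<And>b. b \<in> B \<Longrightarrow> parabola_inside K x u n b" "\<And>b. b \<in> B \<Longrightarrow> parabola_inside K x u n (- b)"
    by (auto simp: eventually_sequentially)
  have region: "x + w - l *\<^sub>R u \<in> K"
    if w: "w \<bullet> u = 0" "norm w \<le> 1 / (real n * N)" and l: "real n * N\<^sup>2 * (norm w)\<^sup>2 \<le> l" "l \<le> 1 / real n" for w l
  proof -
    have "(\<Sum>b\<in>S. (w \<bullet> b) *\<^sub>R b) = w"
      using S finS by (intro orthonormal_basis_expand) auto
    then have wB: "(\<Sum>b\<in>B. (w \<bullet> b) *\<^sub>R b) = w"
      using w(1) finS S(1) by (simp add: B_def sum.remove[OF finS S(1)])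
    have pt: "x + (N * (w \<bullet> b)) *\<^sub>R b - l *\<^sub>R u \<in> K" if b: "b \<in> B" for b
    proof -
      define m where "m = N * \<bar>w \<bullet> b\<bar>"
      have wb: "\<bar>w \<bullet> b\<bar> \<le> norm w" using Cauchy_Schwarz_ineq2[of w b] B(1)[OF b] by simp
      have "m \<le> N * norm w" using wb N1 by (simp add: m_def)
      also have "\<dots> \<le> N * (1 / (real n * N))" using w N1 by (intro mult_left_mono) auto
      also have "\<dots> = 1 / real n" using N1 by simp
      finally have m1: "0 \<le> m" "m \<le> 1 / real n" using N1 by (auto simp: m_def)
      have "real n * m\<^sup>2 \<le> real n * (N * norm w)\<^sup>2"
        using wb N1 by (intro mult_left_mono power_mono) (auto simp: m_def)
      also have "\<dots> \<le> l" using l by (simp add: power_mult_distrib mult.assoc)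
      finally have m2: "real n * m\<^sup>2 \<le> l" .
      show ?thesis
      proof (cases "w \<bullet> b \<ge> 0")
        case True
        then have "N * (w \<bullet> b) = m" by (simp add: m_def)
        then show ?thesis using n(2)[OF b] m1 m2 l unfolding parabola_inside_def by simp
      next
        case False
        then have "(N * (w \<bullet> b)) *\<^sub>R b = m *\<^sub>R (- b)" by (simp add: m_def)
        then show ?thesis using n(3)[OF b] m1 m2 l unfolding parabola_inside_def by metis
      qed
    qed
    have "(\<Sum>b\<in>B. (1 / N) *\<^sub>R (x + (N * (w \<bullet> b)) *\<^sub>R b - l *\<^sub>R u)) \<in> K"
      using N1 pt by (intro convex_sum[OF finB K]) (auto simp: N_def)
    also have "(\<Sum>b\<in>B. (1 / N) *\<^sub>R (x + (N * (w \<bullet> b)) *\<^sub>R b - l *\<^sub>R u)) = (\<Sum>b\<in>B. (1 / N) *\<^sub>R (x - l *\<^sub>R u) + (w \<bullet> b) *\<^sub>R b)"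
      using N1 by (intro sum.cong) (auto simp: algebra_simps)
    also have "\<dots> = (N * (1 / N)) *\<^sub>R (x - l *\<^sub>R u) + w"
      by (simp add: sum.distrib wB N_def sum_constant_scaleR)
    also have "\<dots> = x + w - l *\<^sub>R u" using N1 by simp
    finally show ?thesis .
  qed
  define \<rho> where "\<rho> = 1 / (2 * real n * N\<^sup>2)"
  have \<rho>: "\<rho> > 0" "2 * \<rho> * (real n * N\<^sup>2) = 1" using n N1 by (auto simp: \<rho>_def)
  have NN: "N \<le> N\<^sup>2" using N1 by (simp add: power2_eq_square)
  have \<rho>1: "2 * \<rho> \<le> 1 / (real n * N)" "1 / (real n * N) \<le> 1 / real n"
    using n N1 NN by (auto simp: \<rho>_def field_simps)
  have "p \<in> K" if p: "p \<in> cball (x - \<rho> *\<^sub>R u) \<rho>" for p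
  proof -
    define l where "l = (x - p) \<bullet> u"
    define w where "w = p - x + l *\<^sub>R u"
    have wu: "w \<bullet> u = 0" using u by (simp add: w_def l_def inner_add_left inner_diff_left norm_eq_1)
    have "(norm (w + (\<rho> - l) *\<^sub>R u))\<^sup>2 \<le> \<rho>\<^sup>2"
    proof (rule power_mono)
      have "w + (\<rho> - l) *\<^sub>R u = p - (x - \<rho> *\<^sub>R u)" by (simp add: w_def algebra_simps)
      then show "norm (w + (\<rho> - l) *\<^sub>R u) \<le> \<rho>" using p by (simp add: dist_norm norm_minus_commute)
    qed simp
    also have "(norm (w + (\<rho> - l) *\<^sub>R u))\<^sup>2 = (norm w)\<^sup>2 + (\<rho> - l)\<^sup>2"
      unfolding power2_norm_eq_inner using wu u
      by (simp add: inner_add_left inner_add_right inner_commute norm_eq_1 power2_eq_square)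
    finally have wl: "(norm w)\<^sup>2 + l * l \<le> 2 * \<rho> * l" by (simp add: power2_eq_square algebra_simps)
    have l0: "0 \<le> l"
    proof (rule ccontr)
      assume "\<not> 0 \<le> l"
      then have "\<rho> * l < 0" using \<rho> by (simp add: mult_pos_neg)
      then show False using wl zero_le_power2[of "norm w"] zero_le_square[of l] by linarith
    qed
    have "l * l \<le> 2 * \<rho> * l" using wl zero_le_power2[of "norm w"] by linarith
    then have l1: "l \<le> 2 * \<rho>" using l0 \<rho> by (cases "l = 0") auto
    have w2: "(norm w)\<^sup>2 \<le> 2 * \<rho> * l" using wl zero_le_square[of l] by linarith
    also have "\<dots> \<le> 2 * \<rho> * (2 * \<rho>)" using l1 \<rho> by (intro mult_left_mono) auto
    finally have "(norm w)\<^sup>2 \<le> (2 * \<rho>)\<^sup>2" by (simp add: power2_eq_square)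
    then have nw: "norm w \<le> 2 * \<rho>" by (rule power2_le_imp_le) (use \<rho> in simp)
    have "real n * N\<^sup>2 * (norm w)\<^sup>2 \<le> real n * N\<^sup>2 * (2 * \<rho> * l)"
      using w2 by (intro mult_left_mono) auto
    also have "\<dots> = (2 * \<rho> * (real n * N\<^sup>2)) * l" by (simp add: mult_ac)
    finally have "real n * N\<^sup>2 * (norm w)\<^sup>2 \<le> l" unfolding \<rho>(2) by simp
    then have "x + w - l *\<^sub>R u \<in> K" using nw l1 \<rho>1 wu by (intro region) auto
    then show ?thesis by (simp add: w_def)
  qed
  then show ?thesis using \<rho> by blast
qed

lemma orthogonal_projection_plane:
  fixes K :: "'a::euclidean_space set"
  assumes u: "norm u = 1" and t: "norm t = 1" "orthogonal u t"
  shows "orthogonal_projection K (plane_through x u t) =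
    (\<lambda>p. x + ((p - x) \<bullet> u) *\<^sub>R u + ((p - x) \<bullet> t) *\<^sub>R t) ` K" (is "_ = ?f ` K")
proof (intro equalityI subsetI)
  have uu: "u \<bullet> u = 1" "t \<bullet> t = 1" "u \<bullet> t = 0" "t \<bullet> u = 0"
    using assms by (auto simp: orthogonal_def norm_eq_1 inner_commute)
  fix y assume "y \<in> orthogonal_projection K (plane_through x u t)"
  then obtain z where y: "y \<in> plane_through x u t" and z: "z \<in> K"
    "\<And>v. v \<in> plane_through x u t \<Longrightarrow> (z - y) \<bullet> (v - y) = 0"
    by (auto simp: orthogonal_projection_def orthogonal_def)
  obtain l m where lm: "y = x + l *\<^sub>R u + m *\<^sub>R t" using y in_plane_through_iff by blast
  have "y + u = x + (l + 1) *\<^sub>R u + m *\<^sub>R t" "y + t = x + l *\<^sub>R u + (m + 1) *\<^sub>R t"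
    by (simp_all add: lm algebra_simps)
  then have "y + u \<in> plane_through x u t" "y + t \<in> plane_through x u t"
    unfolding in_plane_through_iff by blast+
  then have "(z - y) \<bullet> u = 0" "(z - y) \<bullet> t = 0" using z(2) by force+
  then have "(z - x) \<bullet> u = l" "(z - x) \<bullet> t = m"
    using uu by (simp_all add: lm inner_diff_left inner_add_left)
  then show "y \<in> ?f ` K" using z(1) lm by blast
next
  have uu: "u \<bullet> u = 1" "t \<bullet> t = 1" "u \<bullet> t = 0" "t \<bullet> u = 0"
    using assms by (auto simp: orthogonal_def norm_eq_1 inner_commute)
  fix y assume "y \<in> ?f ` K"
  then obtain z where z: "z \<in> K" "y = ?f z" by blast
  have zy: "(z - y) \<bullet> u = 0" "(z - y) \<bullet> t = 0"
    using uu by (simp_all add: z inner_diff_left inner_add_left)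
  have "orthogonal (z - y) (v - y)" if v: "v \<in> plane_through x u t" for v
  proof -
    obtain l m where "v = x + l *\<^sub>R u + m *\<^sub>R t" using v unfolding in_plane_through_iff by blast
    then have "v - y = (l - (z - x) \<bullet> u) *\<^sub>R u + (m - (z - x) \<bullet> t) *\<^sub>R t"
      by (simp add: z(2) algebra_simps)
    then show ?thesis using zy by (simp add: orthogonal_def inner_add_right)
  qed
  moreover have "y \<in> plane_through x u t" using z(2) in_plane_through_iff by blast
  ultimately show "y \<in> orthogonal_projection K (plane_through x u t)"
    using z(1) by (auto simp: orthogonal_projection_def)
qed

text \<open>The projection lies in the unit disc around \<open>x - u\<close>, so the upper radius is at most \<open>1\<close>. If it is smaller than
\<open>c < 1\<close>, the inequality for circles of radius \<open>c\<close> holds at relative boundary points near \<open>x\<close>; any other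
point of the projection near \<open>x\<close> lies below such a boundary point, which only increases the right-hand side.\<close>

lemma planar_upper_radius_projection:
  fixes K :: "'a::euclidean_space set" and t u x
  defines "M \<equiv> orthogonal_projection K (plane_through x u t)"
  assumes K: "K \<in> bodies_of_constant_width_1" and x: "x \<in> K" "outer_unit_normal K x u"
    and t: "norm t = 1" "orthogonal u t"
  shows "planar_upper_radius M x u t = 1 \<or>
    (\<exists>c\<ge>0. c < 1 \<and> (\<exists>d>0. \<forall>p\<in>K. dist p x < d \<longrightarrow> 0 < (p - x) \<bullet> t \<longrightarrow>
       ((p - x) \<bullet> t)\<^sup>2 \<le> 2 * c * ((x - p) \<bullet> u)))"
proof (cases "planar_upper_radius M x u t = 1")
  case ne: False
  note c = constant_width_1_bodyD[OF K]
  have u: "norm u = 1" using x(2) by (simp add: outer_unit_normal_def)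
  let ?f = "\<lambda>p. x + ((p - x) \<bullet> u) *\<^sub>R u + ((p - x) \<bullet> t) *\<^sub>R t"
  have M: "M = ?f ` K" unfolding M_def by (rule orthogonal_projection_plane[OF u t])
  have "compact M" unfolding M by (intro compact_continuous_image continuous_intros c(1))
  have fx: "?f x = x" "?f (x - u) = x - u"
    using u t by (simp_all add: orthogonal_def norm_eq_1)
  have xM: "x \<in> M" "x - u \<in> M" unfolding M
    using image_eqI[where f = ?f, OF fx(1)[symmetric] x(1)]
      image_eqI[where f = ?f, OF fx(2)[symmetric] constant_width_1_antipode[OF K x]]
    by blast+
  have disc: "l\<^sup>2 + m\<^sup>2 \<le> - 2 * l" if lm: "x + l *\<^sub>R u + m *\<^sub>R t \<in> M" for l m
  proof -
    obtain p where p: "p \<in> K" "x + l *\<^sub>R u + m *\<^sub>R t = ?f p" using lm unfolding M by blast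
    have "l = (p - x) \<bullet> u" "m = (p - x) \<bullet> t"
      using plane_coordinates[OF u t, of x l m] unfolding p(2) plane_coordinates[OF u t] by simp_all
    then show ?thesis
      using plane_Bessel[OF u t, of "p - x"] constant_width_1_in_unit_ball[OF K x p(1)] by simp
  qed
  have neg: "l < 0" if "x + l *\<^sub>R u + m *\<^sub>R t \<in> M" "m > 0" for l m
  proof -
    have "0 < m\<^sup>2" using that by simp
    then show ?thesis using disc[OF that(1)] zero_le_power2[of l] by linarith
  qed
  have radius: "circle_radius x u t (x + l *\<^sub>R u + m *\<^sub>R t) = ennreal ((l\<^sup>2 + m\<^sup>2) / (- 2 * l))"
    if "x + l *\<^sub>R u + m *\<^sub>R t \<in> M" "m > 0" for l m
    using circle_radius_eq[OF u t] neg[OF that] that(2) by blast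
  have relf: "rel_frontier M \<subseteq> M"
    using \<open>compact M\<close> by (auto simp: rel_frontier_def closure_closed compact_imp_closed)
  have "circle_radius x u t z \<le> 1" if zE: "z \<in> open_half_plane x u t \<inter> rel_frontier M" for z
  proof -
    obtain l m where z: "z = x + l *\<^sub>R u + m *\<^sub>R t" "m > 0" using zE by (auto simp: open_half_plane_def)
    have zM: "x + l *\<^sub>R u + m *\<^sub>R t \<in> M" using zE z relf by blast
    have "(l\<^sup>2 + m\<^sup>2) / (- 2 * l) \<le> 1"
      using disc[OF zM] neg[OF zM z(2)] by (subst pos_divide_le_eq) simp_all
    then show ?thesis unfolding z(1) radius[OF zM z(2)] by simp
  qed
  then have "planar_upper_radius M x u t \<le> 1"
    unfolding planar_upper_radius_def by (intro Limsup_bounded) (auto simp: eventually_at intro: exI[of _ 1])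
  with ne have "planar_upper_radius M x u t < 1" by simp
  then obtain y where y: "planar_upper_radius M x u t < y" "y < 1" using dense by blast
  then obtain k where k: "y = ennreal k" "0 \<le> k" by (cases y) auto
  have k1: "k < 1" using y(2) k by (metis ennreal_1 ennreal_less_iff)
  have "\<forall>\<^sub>F z in at x within (open_half_plane x u t \<inter> rel_frontier M). circle_radius x u t z < y"
    using Limsup_lessD y(1) unfolding planar_upper_radius_def by blast
  then obtain d where d: "d > 0" "\<And>z. z \<in> open_half_plane x u t \<Longrightarrow> z \<in> rel_frontier M \<Longrightarrow> z \<noteq> x \<Longrightarrow>
      dist z x < d \<Longrightarrow> circle_radius x u t z < y"
    by (auto simp: eventually_at)
  have "((p - x) \<bullet> t)\<^sup>2 \<le> 2 * k * ((x - p) \<bullet> u)" if p: "p \<in> K" "dist p x < d" "0 < (p - x) \<bullet> t" for p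
  proof -
    define l m where "l = (p - x) \<bullet> u" and "m = (p - x) \<bullet> t"
    have fp: "x + l *\<^sub>R u + m *\<^sub>R t \<in> M" using p(1) unfolding M l_def m_def by blast
    then obtain s where s: "s \<ge> 0" "x + l *\<^sub>R u + m *\<^sub>R t + s *\<^sub>R u \<in> M"
      "x + l *\<^sub>R u + m *\<^sub>R t + s *\<^sub>R u \<in> rel_frontier M"
      using top_boundary_point[OF \<open>compact M\<close> xM u] by blast
    define h where "h = l + s"
    let ?z = "x + h *\<^sub>R u + m *\<^sub>R t"
    have zs: "x + l *\<^sub>R u + m *\<^sub>R t + s *\<^sub>R u = ?z" by (simp add: h_def algebra_simps)
    have m: "m > 0" using p by (simp add: m_def)
    have h: "h < 0" using neg[OF _ m] s(2) unfolding zs by blast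
    have "\<bar>h\<bar> \<le> \<bar>l\<bar>" using h s(1) by (simp add: h_def)
    then have "h\<^sup>2 \<le> l\<^sup>2" by (rule abs_le_square_iff[THEN iffD1])
    have "(norm (?z - x))\<^sup>2 = h\<^sup>2 + m\<^sup>2" using norm_sq_plane[OF u t, of h m] by (simp add: add.assoc)
    also have "\<dots> \<le> l\<^sup>2 + m\<^sup>2" using \<open>h\<^sup>2 \<le> l\<^sup>2\<close> by simp
    also have "\<dots> \<le> (norm (p - x))\<^sup>2" using plane_Bessel[OF u t, of "p - x"] by (simp add: l_def m_def)
    finally have "norm (?z - x) \<le> norm (p - x)" by (rule power2_le_imp_le) simp
    then have "dist ?z x < d" using p(2) by (simp only: dist_norm)
    moreover have "?z \<noteq> x"
    proof
      assume "?z = x"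
      then have "(?z - x) \<bullet> t = 0" by simp
      then show False using plane_coordinates(2)[OF u t, of x h m] m by simp
    qed
    moreover have "?z \<in> open_half_plane x u t" using m by (auto simp: open_half_plane_def)
    ultimately have "circle_radius x u t ?z < y" using d(2) s(3) unfolding zs by blast
    then have "ennreal ((h\<^sup>2 + m\<^sup>2) / (- 2 * h)) < ennreal k"
      using radius[OF _ m] s(2) unfolding zs k(1) by metis
    moreover have "0 \<le> (h\<^sup>2 + m\<^sup>2) / (- 2 * h)"
      using h by (intro divide_nonneg_nonneg) simp_all
    ultimately have "(h\<^sup>2 + m\<^sup>2) / (- 2 * h) < k" by (simp only: ennreal_less_iff)
    moreover have "0 < - 2 * h" using h by simp
    ultimately have "h\<^sup>2 + m\<^sup>2 < k * (- 2 * h)" by (simp only: pos_divide_less_eq)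
    moreover have "k * (- 2 * h) = 2 * k * (- h)" by simp
    ultimately have "m\<^sup>2 \<le> 2 * k * (- h)" using zero_le_power2[of h] by linarith
    also have "\<dots> \<le> 2 * k * (- l)" using s(1) k by (intro mult_left_mono) (auto simp: h_def)
    also have "- l = (x - p) \<bullet> u" by (simp add: l_def inner_diff_left)
    finally show ?thesis by (simp add: m_def)
  qed
  then show ?thesis using k k1 d(1) by blast
qed simp

section \<open>Curvature of typical bodies of constant width\<close>

text \<open>If neither alternative holds, there are an inner ball of radius \<open>\<rho>\<close> at \<open>x\<close> and a direction with upper tangential
radius smaller than some \<open>c < 1\<close>; the excluded condition holds for every
\<open>1 / (k + 1)\<close> below \<open>\<rho>\<close>, \<open>1 - c\<close> and the size of the neighbourhood on which \<open>c\<close> is a bound.\<close>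

theorem curvature_dichotomy:
  fixes K :: "'a::euclidean_space set"
  assumes dim: "DIM('a) \<ge> 2" and K: "K \<in> bodies_of_constant_width_1"
    and x: "x \<in> K" "outer_unit_normal K x u"
    and unique: "\<And>v. outer_unit_normal K x v \<Longrightarrow> v = u"
    and not_subunit: "\<And>k t. norm t = 1 \<Longrightarrow> \<not> subunit_radius_at (1 / real (Suc k)) K x u t"
  shows "(\<forall>t. norm t = 1 \<and> orthogonal u t \<longrightarrow> upper_tangential_radius K u t = 1) \<or>
    (\<exists>t. norm t = 1 \<and> orthogonal u t \<and> lower_sectional_radius K u t = 0)"
proof (rule ccontr)
  assume contra: "\<not> ?thesis"
  have u: "norm u = 1" using x(2) by (simp add: outer_unit_normal_def)
  have "support_element K x u"
    using x by (simp add: support_element_closed_iff constant_width_1_bodyD[OF K])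
  then have xu: "support_point K u = x"
    unfolding support_point_def by (rule the1_equality[OF constant_width_1_unique_support_point[OF K u]])
  have "planar_lower_radius (K \<inter> plane_through x u t) x u t \<noteq> 0" if "norm t = 1" "orthogonal u t" for t
    using contra that by (auto simp: lower_sectional_radius_def xu)
  then obtain \<rho> where \<rho>: "\<rho> > 0" "cball (x - \<rho> *\<^sub>R u) \<rho> \<subseteq> K"
    using inner_ball_if_parabolas_inside[OF constant_width_1_bodyD(2)[OF K] u dim]
      parabola_inside_if_positive_lower_radius[OF K x unique] by metis
  obtain t where t: "norm t = 1" "orthogonal u t" and "upper_tangential_radius K u t \<noteq> 1"
    using contra by blast
  then have "planar_upper_radius (orthogonal_projection K (plane_through x u t)) x u t \<noteq> 1"
    by (simp add: upper_tangential_radius_def xu)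
  then obtain c d where c: "c \<ge> 0" "c < 1" "d > 0"
    "\<And>p. p \<in> K \<Longrightarrow> dist p x < d \<Longrightarrow> 0 < (p - x) \<bullet> t \<Longrightarrow> ((p - x) \<bullet> t)\<^sup>2 \<le> 2 * c * ((x - p) \<bullet> u)"
    using planar_upper_radius_projection[OF K x t] by blast
  obtain k where k: "1 / real (Suc k) < min \<rho> (min d (1 - c))"
    using nat_approx_posE[of "min \<rho> (min d (1 - c))"] \<rho>(1) c by auto
  define s where "s = 1 / real (Suc k)"
  have s: "0 < s" "s \<le> \<rho>" "s \<le> d" "c \<le> 1 - s" using k by (auto simp: s_def)
  have "cball (x - s *\<^sub>R u) s \<subseteq> cball (x - \<rho> *\<^sub>R u) \<rho>"
  proof -
    have "x - s *\<^sub>R u - (x - \<rho> *\<^sub>R u) = (\<rho> - s) *\<^sub>R u" by (simp add: algebra_simps)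
    then have "dist (x - s *\<^sub>R u) (x - \<rho> *\<^sub>R u) + s \<le> \<rho>"
      using u s by (simp add: dist_norm)
    then show ?thesis by (simp add: cball_subset_cball_iff)
  qed
  moreover have "((p - x) \<bullet> t)\<^sup>2 \<le> 2 * (1 - s) * ((x - p) \<bullet> u)"
    if p: "p \<in> K" "dist p x < s" "0 < (p - x) \<bullet> t" for p
  proof -
    have "p \<bullet> u \<le> x \<bullet> u" using x(2) p(1) by (simp add: outer_unit_normal_def)
    then have "2 * c * ((x - p) \<bullet> u) \<le> 2 * (1 - s) * ((x - p) \<bullet> u)"
      using s by (intro mult_right_mono) (auto simp: inner_diff_left)
    with c(4)[OF p(1) _ p(3)] p(2) s show ?thesis by simp
  qed
  ultimately have "subunit_radius_at s K x u t"
    using x(2) t(2) \<rho>(2) unfolding subunit_radius_at_def by blast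
  then show False using not_subunit[OF t(1), of k] by (simp add: s_def)
qed

theorem typical_curvature:
  assumes dim: "DIM('a::euclidean_space) \<ge> 2"
  shows "typical_constant_width_1 (\<lambda>K :: 'a set.
    \<forall>x u. support_element K x u \<longrightarrow>
      regular_support_element K x u \<and>
      ((\<forall>t. norm t = 1 \<and> orthogonal u t \<longrightarrow> upper_tangential_radius K u t = 1) \<or>
       (\<exists>t. norm t = 1 \<and> orthogonal u t \<and> lower_sectional_radius K u t = 0)))"
    (is "typical_constant_width_1 ?P")
proof -
  have top: "topspace constant_width_1_topology = (bodies_of_constant_width_1 :: 'a set set)"
    unfolding constant_width_1_topology_def
    by (rule Metric_space.topspace_mtopology[OF Metric_space_constant_width_1])
  obtain D :: "'a set" where D: "countable D" "\<And>X. open X \<Longrightarrow> X \<noteq> {} \<Longrightarrow> \<exists>d\<in>D. d \<in> X"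
    using countable_dense_setE[where 'a = 'a] by blast
  let ?r = "\<lambda>k. 1 / real (Suc k)"
  let ?\<N> = "range (\<lambda>k. nonsmooth_bodies (?r k)) \<union>
    (\<lambda>(d, k). subunit_radius_bodies d (?r k)) ` (D \<times> (UNIV :: nat set))"
  have good: "?P K" if K: "K \<in> bodies_of_constant_width_1" and smooth: "\<And>k. K \<notin> nonsmooth_bodies (?r k)"
    and flat: "\<And>d k. d \<in> D \<Longrightarrow> K \<notin> subunit_radius_bodies d (?r k)" for K
  proof (intro allI impI conjI)
    fix x u assume xu: "support_element K x u"
    then have x: "x \<in> K" "outer_unit_normal K x u"
      by (simp_all add: support_element_closed_iff constant_width_1_bodyD[OF K])
    have u: "norm u = 1" using x(2) by (simp add: outer_unit_normal_def)
    have unique: "v = u" if v: "outer_unit_normal K x v" for v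
    proof (rule ccontr)
      assume "v \<noteq> u"
      then obtain k where "?r k < dist u v" using nat_approx_posE[of "dist u v"] by auto
      then have "K \<in> nonsmooth_bodies (?r k)"
        unfolding nonsmooth_bodies_def using K x u v outer_unit_normal_def[of K x v]
        by (intro CollectI conjI exI[of _ x] exI[of _ u] exI[of _ v]) auto
      then show False using smooth by blast
    qed
    show "regular_support_element K x u"
      unfolding regular_support_element_def
    proof (intro conjI ballI allI impI xu unique)
      fix y assume "y \<in> frontier K" "outer_unit_normal K y u"
      then have "support_element K y u" by (simp add: support_element_def)
      then show "y = x" using constant_width_1_unique_support_point[OF K u] xu by blast
    qed
    obtain d where d: "d \<in> D" "dist u d < 1/8" using D(2)[of "ball u (1/8)"] by auto
    have "\<not> subunit_radius_at (?r k) K x u t" if "norm t = 1" for k t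
    proof
      assume "subunit_radius_at (?r k) K x u t"
      then have "K \<in> subunit_radius_bodies d (?r k)"
        unfolding subunit_radius_bodies_def using K x u that d(2)
        by (intro CollectI conjI exI[of _ x] exI[of _ u] exI[of _ t]) auto
      then show False using flat d(1) by blast
    qed
    then show "(\<forall>t. norm t = 1 \<and> orthogonal u t \<longrightarrow> upper_tangential_radius K u t = 1) \<or>
       (\<exists>t. norm t = 1 \<and> orthogonal u t \<and> lower_sectional_radius K u t = 0)"
      by (intro curvature_dichotomy[OF dim K x unique])
  qed
  show ?thesis
    unfolding typical_constant_width_1_def
  proof (rule comeagre_inI[of _ _ ?\<N>])
    show "{K \<in> bodies_of_constant_width_1. ?P K} \<subseteq> topspace constant_width_1_topology"
      by (auto simp: top)
    show "countable ?\<N>" using D(1) by simp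
    show "nowhere_dense_in constant_width_1_topology N" if "N \<in> ?\<N>" for N :: "'a set set"
    proof -
      from that consider k where "N = nonsmooth_bodies (?r k)" | d k where "N = subunit_radius_bodies d (?r k)"
        by auto
      then show ?thesis
        by cases (simp_all add: nowhere_dense_nonsmooth_bodies nowhere_dense_subunit_radius_bodies)
    qed
    show "topspace constant_width_1_topology - {K \<in> bodies_of_constant_width_1. ?P K} \<subseteq> \<Union> ?\<N>"
    proof
      fix K assume "K \<in> topspace constant_width_1_topology - {K \<in> bodies_of_constant_width_1. ?P K}"
      then have K: "K \<in> bodies_of_constant_width_1" and bad: "\<not> ?P K" unfolding top by simp_all
      show "K \<in> \<Union> ?\<N>"
      proof (rule ccontr)
        assume no: "K \<notin> \<Union> ?\<N>"
        have "?P K"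
        proof (rule good[OF K])
          show "K \<notin> nonsmooth_bodies (?r k)" for k using no by auto
          show "K \<notin> subunit_radius_bodies d (?r k)" if "d \<in> D" for d k using no that by auto
        qed
        with bad show False by contradiction
      qed
    qed
  qed
qed

theorem theorem6p2:
  assumes "CARD('n::finite) \<ge> 2"
  shows "typical_constant_width_1 (\<lambda>K :: (real ^ 'n) set.
    \<forall>x u. support_element K x u \<longrightarrow>
      regular_support_element K x u \<and>
      ((\<forall>t. norm t = 1 \<and> orthogonal u t \<longrightarrow> upper_tangential_radius K u t = 1) \<or>
       (\<exists>t. norm t = 1 \<and> orthogonal u t \<and> lower_sectional_radius K u t = 0)))"
  using assms by (intro typical_curvature) simp

end
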